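(* Let $M\ge 1$ be a fixed integer, let $\alpha\in[0,1/2)$, and let $R\in\{1,\dots,M\}$ satisfy $R\ge M(1-\alpha)$. Assume that, for every $m=1,\dots,R$, the classifier $g_{mk}$ converges in probability to the Bayes rule $g^*$ as $k\to\infty$, i.e. $\mathbb{P}_{\mathcal{D}_k}(g_{mk}(X)\neq g^*(X))\to 0$ in probability as $k\to\infty$. Assume moreover that $$\mathbb{P}(Y=1\mid g^*(X)=1)>1/2\quad\text{and}\quad \mathbb{P}(Y=0\mid g^*(X)=0)>1/2 .$$ Then: (a) $\displaystyle\lim_{\min\{k,l\}\to\infty}\mathbb{P}_{\mathcal{D}_k}\big(g_T(X,\alpha)\neq Y\big)-L^*=0$ (limit in probability). (b) For $m=1,\dots,R$ let $(\beta_{mk})_{k\ge1}$ be a deterministic nonnegative sequence with $\beta_{mk}\to 0$ as $k\to\infty$, and put $\boldsymbol{\beta_{Rk}}=\max_{m=1,\dots,R}\beta_{mk}$. If $\mathbb{P}_{\mathcal{D}_k}\big(g^*(X)\neq g_{mk}(X)\big)=\mathcal{O}(\beta_{mk})$ for every $m=1,\dots,R$, then, for $k$ large enough, $$\mathbb{P}_{\mathcal{D}_k}\big(g_T(X,\alpha)\neq Y\big)-L^*=\mathcal{O}\Big(\max\big\{\exp(-Cl),\boldsymbol{\beta_{Rk}}\big\}\Big)$$ for some constant $C>0$.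
   Context: Let $\mathcal{F}$ be a separable and complete metric space and $(X,Y)$ a random pair with values in $\mathcal{F}\times\{0,1\}$. Let $\eta(x)=\mathbb{E}(Y\mid X=x)=\mathbb{P}(Y=1\mid X=x)$ be the regression function, $g^*(x)=\mathbb{I}_{\{\eta(x)>1/2\}}$ the Bayes rule, and $L^*=\mathbb{P}(g^*(X)\neq Y)$ the optimal Bayes risk. The training sample $\mathcal{D}_n=\{(X_1,Y_1),\dots,(X_n,Y_n)\}$ consists of iid copies of $(X,Y)$, and $(X,Y)$ is independent of $\mathcal{D}_n$. Write $n=k+l$ with $l\ge1$, and split the sample into $\mathcal{D}_k=\{(X_1,Y_1),\dots,(X_k,Y_k)\}$ and $\mathcal{E}_l=\{(X_{k+1},Y_{k+1}),\dots,(X_n,Y_n)\}$. Using only $\mathcal{D}_k$, one builds $M$ classifiers $g_{mk}:\mathcal{F}\to\{0,1\}$, $m=1,\dots,M$ (measurable functions of $x$ and $\mathcal{D}_k$, otherwise arbitrary), and sets $\mathbf{g_k}(x)=(g_{1k}(x),\dots,g_{Mk}(x))$. For $0\le\alpha<1$ the aggregated classifier is $$g_T(x,\alpha)=\mathbb{I}_{\{T_n(\mathbf{g_k}(x),\alpha)>1/2\}},\qquad T_n(\mathbf{g_k}(x),\alpha)=\sum_{j=k+1}^n W_{n,j}(x)Y_j,\quad x\in\mathcal{F},$$ with weights $$W_{n,j}(x)=\frac{\mathbb{I}_{\left\{\frac1M\sum_{m=1}^M\mathbb{I}_{\{g_{mk}(x)=g_{mk}(X_j)\}}\ge 1-\alpha\right\}}}{\sum_{i=k+1}^n\mathbb{I}_{\left\{\frac1M\sum_{m=1}^M\mathbb{I}_{\{g_{mk}(x)=g_{mk}(X_i)\}}\ge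 1-\alpha\right\}}},$$ where $0/0$ is taken to be $0$. $\mathbb{P}_{\mathcal{D}_k}(\cdot)=\mathbb{P}(\cdot\mid\mathcal{D}_k)$ denotes conditional probability given $\mathcal{D}_k$ (so $\mathbb{P}_{\mathcal{D}_k}(g_T(X,\alpha)\neq Y)$ averages over both $(X,Y)$ and $\mathcal{E}_l$). These are random quantities. The $\mathcal{O}$ relations in (b), in the hypothesis and in the conclusion, are understood for almost every realization of the training sequence $(X_1,Y_1),(X_2,Y_2),\dots$: $a_k=\mathcal{O}(b_k)$ means $|a_k|\le A\,b_k$ for all $k\ge k_0$, for some finite $A$ and $k_0$ (possibly depending on the realization); in the conclusion the bound holds for all $k\ge k_0$ and all $l\ge 1$, with $A$ independent of $k$ and $l$. *)

theory Defs
  imports "HOL-Probability.Probability"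
begin

definition obs_space :: "('a::polish_space \<times> nat) measure" where
  "obs_space = borel \<Otimes>\<^sub>M count_space {0, 1}"

text \<open>
  \<open>\<eta>(x) = E(Y | X = x)\<close>: a measurable function such that \<open>\<eta> \<circ> X\<close> is a version of
  \<open>E(Y | \<sigma>(X))\<close>. It is unique only up to null sets of the law of \<open>X\<close>.
\<close>

definition regression_function ::
  "'w measure \<Rightarrow> ('w \<Rightarrow> 'a::polish_space) \<Rightarrow> ('w \<Rightarrow> nat) \<Rightarrow> ('a \<Rightarrow> real) \<Rightarrow> bool" where
  "regression_function P X Y \<eta> \<longleftrightarrow>
     \<eta> \<in> borel_measurable borel \<and>
     (AE \<omega> in P. \<eta> (X \<omega>) =
        real_cond_exp P (vimage_algebra (space P) X borel) (\<lambda>\<omega>. real (Y \<omega>)) \<omega>)"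

definition bayes_rule :: "('a \<Rightarrow> real) \<Rightarrow> 'a \<Rightarrow> nat" where
  "bayes_rule \<eta> x = (if \<eta> x > 1/2 then 1 else 0)"

definition bayes_risk :: "'w measure \<Rightarrow> ('w \<Rightarrow> 'a) \<Rightarrow> ('w \<Rightarrow> nat) \<Rightarrow> ('a \<Rightarrow> real) \<Rightarrow> real" where
  "bayes_risk P X Y \<eta> = \<P>(\<omega> in P. bayes_rule \<eta> (X \<omega>) \<noteq> Y \<omega>)"

text \<open>
  \<open>D i\<close> is the pair \<open>(X\<^sub>i, Y\<^sub>i)\<close>; only indices \<open>i \<ge> 1\<close> are used. The sample of the first
  \<open>k\<close> pairs is an element of the product space over \<open>{1..k}\<close>.
\<close>

definition first_sample :: "(nat \<Rightarrow> 'w \<Rightarrow> 'a \<times> nat) \<Rightarrow> nat \<Rightarrow> 'w \<Rightarrow> nat \<Rightarrow> 'a \<times> nat" where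
  "first_sample D k \<omega> = (\<lambda>i\<in>{1..k}. D i \<omega>)"

text \<open>The conditional probability of the event \<open>A\<close> given the first \<open>k\<close> pairs.\<close>

definition prob_given_first ::
  "'w measure \<Rightarrow> (nat \<Rightarrow> 'w \<Rightarrow> 'a::polish_space \<times> nat) \<Rightarrow> nat \<Rightarrow> 'w set \<Rightarrow> 'w \<Rightarrow> real" where
  "prob_given_first P D k A =
     real_cond_exp P
       (vimage_algebra (space P) (first_sample D k) (\<Pi>\<^sub>M i\<in>{1..k}. obs_space))
       (indicator A)"

definition tendsto_in_prob ::
  "'w measure \<Rightarrow> ('i \<Rightarrow> 'w \<Rightarrow> real) \<Rightarrow> real \<Rightarrow> 'i filter \<Rightarrow> bool" where
  "tendsto_in_prob P U c F \<longleftrightarrow>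
     (\<forall>\<epsilon>>0. ((\<lambda>i. \<P>(\<omega> in P. \<bar>U i \<omega> - c\<bar> > \<epsilon>)) \<longlongrightarrow> 0) F)"

text \<open>
  Below \<open>h m\<close>, for \<open>m = 1, \<dots>, M\<close>, are the \<open>M\<close> classifiers already built from the first \<open>k\<close>
  pairs, and \<open>z i\<close> is a realization of the \<open>i\<close>-th pair. The convention \<open>0/0 = 0\<close> for
  the weights is that of real division in HOL.
\<close>

definition agree :: "nat \<Rightarrow> real \<Rightarrow> (nat \<Rightarrow> 'a \<Rightarrow> nat) \<Rightarrow> 'a \<Rightarrow> 'a \<Rightarrow> bool" where
  "agree M \<alpha> h x x' \<longleftrightarrow> 1 / real M * (\<Sum>m=1..M. of_bool (h m x = h m x')) \<ge> 1 - \<alpha>"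

definition weight ::
  "nat \<Rightarrow> real \<Rightarrow> (nat \<Rightarrow> 'a \<Rightarrow> nat) \<Rightarrow> nat \<Rightarrow> nat \<Rightarrow> (nat \<Rightarrow> 'a \<times> nat) \<Rightarrow> nat \<Rightarrow> 'a \<Rightarrow> real" where
  "weight M \<alpha> h k l z j x =
     of_bool (agree M \<alpha> h x (fst (z j))) /
     (\<Sum>i=k+1..k+l. of_bool (agree M \<alpha> h x (fst (z i))))"

definition weighted_vote ::
  "nat \<Rightarrow> real \<Rightarrow> (nat \<Rightarrow> 'a \<Rightarrow> nat) \<Rightarrow> nat \<Rightarrow> nat \<Rightarrow> (nat \<Rightarrow> 'a \<times> nat) \<Rightarrow> 'a \<Rightarrow> real" where
  "weighted_vote M \<alpha> h k l z x = (\<Sum>j=k+1..k+l. weight M \<alpha> h k l z j x * real (snd (z j)))"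

text \<open>\<open>g m k d\<close> is the \<open>m\<close>-th classifier built from the sample \<open>d\<close> of size \<open>k\<close>.\<close>

definition aggregated_classifier ::
  "nat \<Rightarrow> real \<Rightarrow> (nat \<Rightarrow> nat \<Rightarrow> (nat \<Rightarrow> 'a \<times> nat) \<Rightarrow> 'a \<Rightarrow> nat) \<Rightarrow> (nat \<Rightarrow> 'w \<Rightarrow> 'a \<times> nat) \<Rightarrow>
   nat \<Rightarrow> nat \<Rightarrow> 'w \<Rightarrow> 'a \<Rightarrow> nat" where
  "aggregated_classifier M \<alpha> g D k l \<omega> x =
     (if weighted_vote M \<alpha> (\<lambda>m. g m k (first_sample D k \<omega>)) k l (\<lambda>i. D i \<omega>) x > 1/2
      then 1 else 0)"

definition classifier_error ::
  "'w measure \<Rightarrow> ('w \<Rightarrow> 'a::polish_space) \<Rightarrow> (nat \<Rightarrow> 'w \<Rightarrow> 'a \<times> nat) \<Rightarrow> ('a \<Rightarrow> real) \<Rightarrow>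
   (nat \<Rightarrow> nat \<Rightarrow> (nat \<Rightarrow> 'a \<times> nat) \<Rightarrow> 'a \<Rightarrow> nat) \<Rightarrow> nat \<Rightarrow> nat \<Rightarrow> 'w \<Rightarrow> real" where
  "classifier_error P X D \<eta> g m k =
     prob_given_first P D k
       {\<omega> \<in> space P. g m k (first_sample D k \<omega>) (X \<omega>) \<noteq> bayes_rule \<eta> (X \<omega>)}"

definition aggregated_risk ::
  "'w measure \<Rightarrow> ('w \<Rightarrow> 'a::polish_space) \<Rightarrow> ('w \<Rightarrow> nat) \<Rightarrow> (nat \<Rightarrow> 'w \<Rightarrow> 'a \<times> nat) \<Rightarrow>
   nat \<Rightarrow> real \<Rightarrow> (nat \<Rightarrow> nat \<Rightarrow> (nat \<Rightarrow> 'a \<times> nat) \<Rightarrow> 'a \<Rightarrow> nat) \<Rightarrow> nat \<Rightarrow> nat \<Rightarrow> 'w \<Rightarrow> real" where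
  "aggregated_risk P X Y D M \<alpha> g k l =
     prob_given_first P D k
       {\<omega> \<in> space P. aggregated_classifier M \<alpha> g D k l \<omega> (X \<omega>) \<noteq> Y \<omega>}"

end

theory Submission
  imports Defs
begin

text \<open>
  A fresh observation \<open>(X, Y)\<close> and the voting sample are independent of \<open>D\<^sub>k\<close>, so conditioning
  on \<open>D\<^sub>k\<close> amounts to freezing the \<open>M\<close> classifiers and integrating over the rest
  (\<open>real_cond_exp_indicator_indep\<close>, \<open>distr_past_and_fresh\<close>). It remains to study the vote for fixed
  classifiers \<open>h\<^sub>1, \<dots>, h\<^sub>M\<close>; write \<open>s\<close> for the Bayes rule and let the bad set \<open>B\<close> consist of the
  points where some \<open>h\<^sub>m\<close> with \<open>m \<le> R\<close> differs from \<open>s\<close>.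

  Outside \<open>B\<close>, two points of the same class agree on at least \<open>R \<ge> M (1 - \<alpha>)\<close> classifiers, and two
  points of different classes agree on at most \<open>M - R \<le> M \<alpha> < M (1 - \<alpha>)\<close> of them. So, up to \<open>B\<close>,
  the observations that vote at \<open>x\<close> are exactly those in the class of \<open>x\<close>
  (\<open>agree_iff_same_class\<close>). By hypothesis the majority label in each class is the Bayes label: for
  some \<open>c > 0\<close> the centred vote of one observation has mean at least \<open>c\<close> in favour of \<open>s(x)\<close> if \<open>B\<close>
  is ignored. Since \<open>B\<close> costs at most half of its probability, the mean is still at least \<open>c/2\<close> when
  \<open>B\<close> has probability at most \<open>c\<close> (\<open>one_draw_mean_ge\<close>), and Hoeffding's inequality bounds the
  probability of a wrong vote at \<open>x\<close> by \<open>exp (- c\<^sup>2 l / 2)\<close>. If \<open>B\<close> has probability above \<open>c\<close>, the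
  trivial bound 1 is at most \<open>1/c\<close> times this probability. Either way the excess risk is, for
  constants \<open>K\<close> and \<open>C\<close> depending on \<open>c\<close> only, at most
  \<open>K\<close> times the sum of the errors of \<open>h\<^sub>1, \<dots>, h\<^sub>R\<close> with respect to \<open>s\<close>, plus \<open>exp (- C l)\<close>
  (\<open>vote_excess_risk_bound\<close>, \<open>aggregated_excess_risk_bound\<close>). Both parts of the theorem are read off
  from this inequality, which holds almost surely for all \<open>k\<close> and \<open>l\<close> at once.
\<close>

section \<open>Conditioning on an independent variable\<close>

text \<open>
  A conditional expectation given \<open>S\<close> of a function of \<open>S\<close> and an independent \<open>Z\<close> is computed by
  freezing \<open>S\<close>. Independence is stated through the joint law because \<open>S\<close> and \<open>Z\<close> have different
  value types, which \<open>prob_space.indep_var\<close> does not allow.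
\<close>

lemma real_cond_exp_indep:
  fixes f :: "'b \<times> 'c \<Rightarrow> real"
  assumes P: "prob_space P"
    and S [measurable]: "S \<in> P \<rightarrow>\<^sub>M N1" and Z [measurable]: "Z \<in> P \<rightarrow>\<^sub>M N2"
    and ind: "distr P (N1 \<Otimes>\<^sub>M N2) (\<lambda>\<omega>. (S \<omega>, Z \<omega>)) = distr P N1 S \<Otimes>\<^sub>M distr P N2 Z"
    and f [measurable]: "f \<in> borel_measurable (N1 \<Otimes>\<^sub>M N2)"
    and bd: "\<And>q. q \<in> space (N1 \<Otimes>\<^sub>M N2) \<Longrightarrow> \<bar>f q\<bar> \<le> C"
  shows "AE \<omega> in P. real_cond_exp P (vimage_algebra (space P) S N1) (\<lambda>\<omega>. f (S \<omega>, Z \<omega>)) \<omega>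
           = (\<integral>z. f (S \<omega>, z) \<partial>distr P N2 Z)"
proof -
  interpret prob_space P by fact
  let ?F = "vimage_algebra (space P) S N1"
  define LS where "LS = distr P N1 S"
  define LZ where "LZ = distr P N2 Z"
  interpret LS: prob_space LS unfolding LS_def by (rule prob_space_distr) measurable
  interpret LZ: prob_space LZ unfolding LZ_def by (rule prob_space_distr) measurable
  interpret L: pair_prob_space LS LZ ..
  have sLS [measurable_cong, simp]: "sets LS = sets N1" and sLZ [measurable_cong, simp]: "sets LZ = sets N2"
    by (simp_all add: LS_def LZ_def)
  have joint: "distr P (N1 \<Otimes>\<^sub>M N2) (\<lambda>\<omega>. (S \<omega>, Z \<omega>)) = LS \<Otimes>\<^sub>M LZ"
    using ind unfolding LS_def LZ_def .
  have sub: "subalgebra P ?F"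
    unfolding subalgebra_def using S
    by (auto simp: sets_vimage_algebra measurable_iff_sets intro!: sets.sigma_sets_subset)
  interpret finite_measure_subalgebra P ?F by unfold_locales (rule sub)
  have SF: "S \<in> ?F \<rightarrow>\<^sub>M N1"
    by (rule measurable_vimage_algebra1) (use measurable_space[OF S] in auto)
  define V where "V s = (\<integral>z. f (s, z) \<partial>LZ)" for s
  have [measurable]: "V \<in> borel_measurable N1" unfolding V_def by measurable
  have V_bd: "\<bar>V s\<bar> \<le> C" if s: "s \<in> space N1" for s
  proof -
    have int: "integrable LZ (\<lambda>z. f (s, z))"
      by (rule LZ.integrable_const_bound[of _ C]) (use bd s in \<open>auto simp: LZ_def space_pair_measure\<close>)
    have "\<bar>V s\<bar> \<le> (\<integral>z. \<bar>f (s, z)\<bar> \<partial>LZ)" unfolding V_def by (rule integral_abs_bound)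
    also have "\<dots> \<le> (\<integral>z. C \<partial>LZ)"
      using bd s by (intro integral_mono integrable_abs int LZ.integrable_const)
        (auto simp: LZ_def space_pair_measure)
    finally have "\<bar>V s\<bar> \<le> (\<integral>z. C \<partial>LZ)" .
    then show ?thesis by (simp add: LZ.prob_space)
  qed
  \<comment> \<open>\<open>V \<circ> S\<close> has the right integrals over the sets \<open>S \<in> A'\<close> by Fubini for the product law.\<close>
  have "AE \<omega> in P. real_cond_exp P ?F (\<lambda>\<omega>. f (S \<omega>, Z \<omega>)) \<omega> = V (S \<omega>)"
  proof (rule real_cond_exp_charact)
    show "integrable P (\<lambda>\<omega>. f (S \<omega>, Z \<omega>))"
      by (rule integrable_const_bound[of _ C])
        (use bd measurable_space[OF S] measurable_space[OF Z] in \<open>auto simp: space_pair_measure\<close>)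
    show "integrable P (\<lambda>\<omega>. V (S \<omega>))"
      by (rule integrable_const_bound[of _ C]) (use V_bd measurable_space[OF S] in auto)
    show "(\<lambda>\<omega>. V (S \<omega>)) \<in> borel_measurable ?F"
      using SF by measurable
    fix A assume "A \<in> sets ?F"
    then obtain A' where A' [measurable]: "A' \<in> sets N1" and A: "A = S -` A' \<inter> space P"
      using measurable_space[OF S] by (auto simp: sets_vimage_algebra2)
    have "(\<integral>\<omega>\<in>A. f (S \<omega>, Z \<omega>) \<partial>P) = (\<integral>\<omega>. indicator A' (S \<omega>) * f (S \<omega>, Z \<omega>) \<partial>P)"
      unfolding set_lebesgue_integral_def
      by (intro Bochner_Integration.integral_cong) (auto simp: A indicator_def)
    also have "\<dots> = (\<integral>q. indicator A' (fst q) * f q \<partial>(LS \<Otimes>\<^sub>M LZ))"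
      unfolding joint[symmetric] by (subst integral_distr) auto
    also have "\<dots> = (\<integral>s. (\<integral>z. indicator A' s * f (s, z) \<partial>LZ) \<partial>LS)"
    proof (subst L.integral_fst'[symmetric])
      show "integrable (LS \<Otimes>\<^sub>M LZ) (\<lambda>q. indicator A' (fst q) * f q)"
      proof (rule L.integrable_const_bound[of _ C])
        show "AE q in LS \<Otimes>\<^sub>M LZ. norm (indicator A' (fst q) * f q) \<le> C"
        proof (rule AE_I2)
          fix q assume "q \<in> space (LS \<Otimes>\<^sub>M LZ)"
          then have "\<bar>f q\<bar> \<le> C" by (intro bd) (simp add: space_pair_measure LS_def LZ_def)
          then show "norm (indicator A' (fst q) * f q) \<le> C" by (auto simp: indicator_def)
        qed
      qed measurable
    qed simp
    also have "\<dots> = (\<integral>s. indicator A' s * V s \<partial>LS)" by (simp add: V_def)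
    also have "\<dots> = (\<integral>\<omega>. indicator A' (S \<omega>) * V (S \<omega>) \<partial>P)"
      unfolding LS_def by (subst integral_distr) auto
    also have "\<dots> = (\<integral>\<omega>\<in>A. V (S \<omega>) \<partial>P)"
      unfolding set_lebesgue_integral_def
      by (intro Bochner_Integration.integral_cong) (auto simp: A indicator_def)
    finally show "(\<integral>\<omega>\<in>A. f (S \<omega>, Z \<omega>) \<partial>P) = (\<integral>\<omega>\<in>A. V (S \<omega>) \<partial>P)" .
  qed
  then show ?thesis unfolding V_def LZ_def .
qed

lemma real_cond_exp_indicator_indep:
  assumes P: "prob_space P"
    and S [measurable]: "S \<in> P \<rightarrow>\<^sub>M N1" and Z [measurable]: "Z \<in> P \<rightarrow>\<^sub>M N2"
    and ind: "distr P (N1 \<Otimes>\<^sub>M N2) (\<lambda>\<omega>. (S \<omega>, Z \<omega>)) = distr P N1 S \<Otimes>\<^sub>M distr P N2 Z"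
    and E [measurable]: "Measurable.pred (N1 \<Otimes>\<^sub>M N2) (\<lambda>q. E (fst q) (snd q))"
  shows "AE \<omega> in P. real_cond_exp P (vimage_algebra (space P) S N1)
             (indicator {\<omega> \<in> space P. E (S \<omega>) (Z \<omega>)}) \<omega>
           = measure (distr P N2 Z) {z \<in> space (distr P N2 Z). E (S \<omega>) z}"
proof -
  interpret prob_space P by fact
  let ?F = "vimage_algebra (space P) S N1"
  have sub: "subalgebra P ?F"
    unfolding subalgebra_def using S
    by (auto simp: sets_vimage_algebra measurable_iff_sets intro!: sets.sigma_sets_subset)
  interpret finite_measure_subalgebra P ?F by unfold_locales (rule sub)
  have pred: "Measurable.pred P (\<lambda>\<omega>. E (S \<omega>) (Z \<omega>))"
    using measurable_compose[OF measurable_Pair[OF S Z] E] by simp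
  let ?f = "\<lambda>q. of_bool (E (fst q) (snd q)) :: real"
  have "AE \<omega> in P. real_cond_exp P ?F (\<lambda>\<omega>. ?f (S \<omega>, Z \<omega>)) \<omega> = (\<integral>z. ?f (S \<omega>, z) \<partial>distr P N2 Z)"
  proof (rule real_cond_exp_indep[OF P S Z ind, where C = 1])
    show "?f \<in> borel_measurable (N1 \<Otimes>\<^sub>M N2)"
      unfolding of_bool_def by measurable
  qed auto
  moreover have "AE \<omega> in P. real_cond_exp P ?F (\<lambda>\<omega>. ?f (S \<omega>, Z \<omega>)) \<omega>
      = real_cond_exp P ?F (indicator {\<omega> \<in> space P. E (S \<omega>) (Z \<omega>)}) \<omega>"
  proof (rule real_cond_exp_cong)
    note [measurable] = pred
    show "(\<lambda>\<omega>. ?f (S \<omega>, Z \<omega>)) \<in> borel_measurable P" unfolding of_bool_def by simp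
    show "(indicator {\<omega> \<in> space P. E (S \<omega>) (Z \<omega>)} :: _ \<Rightarrow> real) \<in> borel_measurable P" by measurable
    show "AE \<omega> in P. ?f (S \<omega>, Z \<omega>) = indicator {\<omega> \<in> space P. E (S \<omega>) (Z \<omega>)} \<omega>"
      by (intro AE_I2) (auto simp: indicator_def)
  qed
  moreover have "(\<integral>z. ?f (s, z) \<partial>distr P N2 Z) = measure (distr P N2 Z) {z \<in> space (distr P N2 Z). E s z}"
    if s: "s \<in> space N1" for s
  proof -
    interpret LZ: prob_space "distr P N2 Z" by (rule prob_space_distr) fact
    have [measurable]: "{z \<in> space (distr P N2 Z). E s z} \<in> sets (distr P N2 Z)"
      using measurable_compose[OF measurable_Pair1'[OF s] E] by (simp add: pred_def)
    have "(\<integral>z. ?f (s, z) \<partial>distr P N2 Z)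
        = (\<integral>z. indicator {z \<in> space (distr P N2 Z). E s z} z \<partial>distr P N2 Z)"
      by (intro Bochner_Integration.integral_cong) (auto simp: indicator_def)
    then show ?thesis by simp
  qed
  ultimately show ?thesis
    using measurable_space[OF S] by (auto elim!: eventually_elim2 dest!: AE_space[THEN AE_mp] intro: AE_I2)
qed

section \<open>Past sample and fresh observations\<close>

lemma (in prob_space) indep_set_commute:
  "indep_set A B \<Longrightarrow> indep_set B A"
  unfolding indep_sets2_eq by (metis Int_commute mult.commute)

lemma (in prob_space) distr_Pair_eq_if_indep_set:
  assumes X: "X \<in> M \<rightarrow>\<^sub>M N1" and Y: "Y \<in> M \<rightarrow>\<^sub>M N2"
    and ind: "indep_set (sets (vimage_algebra (space M) X N1)) (sets (vimage_algebra (space M) Y N2))"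
  shows "distr M (N1 \<Otimes>\<^sub>M N2) (\<lambda>\<omega>. (X \<omega>, Y \<omega>)) = distr M N1 X \<Otimes>\<^sub>M distr M N2 Y"
proof (rule pair_measure_eqI[symmetric])
  note [measurable] = X Y
  show "sigma_finite_measure (distr M N1 X)" "sigma_finite_measure (distr M N2 Y)"
    by (intro prob_space_imp_sigma_finite prob_space_distr X Y)+
  show "sets (distr M N1 X \<Otimes>\<^sub>M distr M N2 Y) = sets (distr M (N1 \<Otimes>\<^sub>M N2) (\<lambda>\<omega>. (X \<omega>, Y \<omega>)))"
    by simp
  fix A B assume "A \<in> sets (distr M N1 X)" "B \<in> sets (distr M N2 Y)"
  then have [measurable]: "A \<in> sets N1" "B \<in> sets N2" by simp_all
  have "prob ((X -` A \<inter> space M) \<inter> (Y -` B \<inter> space M)) = prob (X -` A \<inter> space M) * prob (Y -` B \<inter> space M)"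
    using ind unfolding indep_sets2_eq by (blast intro: in_vimage_algebra \<open>A \<in> sets N1\<close> \<open>B \<in> sets N2\<close>)
  moreover have "(\<lambda>\<omega>. (X \<omega>, Y \<omega>)) -` (A \<times> B) \<inter> space M = (X -` A \<inter> space M) \<inter> (Y -` B \<inter> space M)"
    by auto
  ultimately show "emeasure (distr M N1 X) A * emeasure (distr M N2 Y) B
      = emeasure (distr M (N1 \<Otimes>\<^sub>M N2) (\<lambda>\<omega>. (X \<omega>, Y \<omega>))) (A \<times> B)"
    by (simp add: emeasure_distr emeasure_eq_measure ennreal_mult)
qed

lemma (in prob_space) distr_Pair_compose:
  assumes X [measurable]: "X \<in> M \<rightarrow>\<^sub>M N1" and Y [measurable]: "Y \<in> M \<rightarrow>\<^sub>M N2"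
    and f [measurable]: "f \<in> N2 \<rightarrow>\<^sub>M N3"
    and ind: "distr M (N1 \<Otimes>\<^sub>M N2) (\<lambda>\<omega>. (X \<omega>, Y \<omega>)) = distr M N1 X \<Otimes>\<^sub>M distr M N2 Y"
  shows "distr M (N1 \<Otimes>\<^sub>M N3) (\<lambda>\<omega>. (X \<omega>, f (Y \<omega>))) = distr M N1 X \<Otimes>\<^sub>M distr M N3 (\<lambda>\<omega>. f (Y \<omega>))"
proof -
  have fY: "distr M N3 (\<lambda>\<omega>. f (Y \<omega>)) = distr (distr M N2 Y) N3 f"
    by (subst distr_distr) (simp_all add: comp_def)
  have "distr M N1 X \<Otimes>\<^sub>M distr M N3 (\<lambda>\<omega>. f (Y \<omega>))
      = distr (distr M N1 X) N1 (\<lambda>x. x) \<Otimes>\<^sub>M distr (distr M N2 Y) N3 f"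
    unfolding fY by (simp add: distr_id2)
  also have "\<dots> = distr (distr M N1 X \<Otimes>\<^sub>M distr M N2 Y) (N1 \<Otimes>\<^sub>M N3) (\<lambda>(x, y). (x, f y))"
  proof (rule pair_measure_distr)
    show "sigma_finite_measure (distr (distr M N2 Y) N3 f)"
      unfolding fY[symmetric] by (intro prob_space_imp_sigma_finite prob_space_distr) measurable
  qed measurable
  also have "\<dots> = distr M (N1 \<Otimes>\<^sub>M N3) (\<lambda>\<omega>. (X \<omega>, f (Y \<omega>)))"
    unfolding ind[symmetric] by (subst distr_distr) (simp_all add: comp_def)
  finally show ?thesis ..
qed

text \<open>
  Independence of \<open>U\<close> from the whole sample of size \<open>k + l\<close> is what makes the first \<open>k\<close> observations
  independent of \<open>U\<close> and the last \<open>l\<close> observations jointly; independence of \<open>U\<close> from the first \<open>k\<close>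
  alone would not suffice.
\<close>

lemma (in prob_space) distr_past_and_fresh:
  fixes k l :: nat
  assumes U [measurable]: "random_variable N U"
    and UD: "distr M (N \<Otimes>\<^sub>M (\<Pi>\<^sub>M i\<in>{1..k+l}. N)) (\<lambda>\<omega>. (U \<omega>, \<lambda>i\<in>{1..k+l}. D i \<omega>))
        = distr M N U \<Otimes>\<^sub>M distr M (\<Pi>\<^sub>M i\<in>{1..k+l}. N) (\<lambda>\<omega>. \<lambda>i\<in>{1..k+l}. D i \<omega>)"
    and D: "indep_vars (\<lambda>_. N) D {1..k+l}" and l: "l \<ge> 1"
  shows "distr M ((\<Pi>\<^sub>M i\<in>{1..k}. N) \<Otimes>\<^sub>M (N \<Otimes>\<^sub>M (\<Pi>\<^sub>M i\<in>{k+1..k+l}. N)))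
             (\<lambda>\<omega>. (\<lambda>i\<in>{1..k}. D i \<omega>, (U \<omega>, \<lambda>i\<in>{k+1..k+l}. D i \<omega>)))
         = distr M (\<Pi>\<^sub>M i\<in>{1..k}. N) (\<lambda>\<omega>. \<lambda>i\<in>{1..k}. D i \<omega>)
             \<Otimes>\<^sub>M distr M (N \<Otimes>\<^sub>M (\<Pi>\<^sub>M i\<in>{k+1..k+l}. N)) (\<lambda>\<omega>. (U \<omega>, \<lambda>i\<in>{k+1..k+l}. D i \<omega>))"
    and "distr M (N \<Otimes>\<^sub>M (\<Pi>\<^sub>M i\<in>{k+1..k+l}. N)) (\<lambda>\<omega>. (U \<omega>, \<lambda>i\<in>{k+1..k+l}. D i \<omega>))
         = distr M N U \<Otimes>\<^sub>M (\<Pi>\<^sub>M i\<in>{k+1..k+l}. distr M N (D i))"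
proof -
  \<comment> \<open>With \<open>U\<close> in position 0 the variables form one independent family, which can be regrouped freely.\<close>
  define V where "V = (\<lambda>i::nat. if i = 0 then U else D i)"
  have rvD: "random_variable N (D i)" if "i \<in> {1..k+l}" for i
    using D that by (auto simp: indep_vars_def)
  have S [measurable]: "(\<lambda>\<omega>. \<lambda>i\<in>{1..k+l}. D i \<omega>) \<in> M \<rightarrow>\<^sub>M (\<Pi>\<^sub>M i\<in>{1..k+l}. N)"
    using rvD by (intro measurable_restrict)
  have S1 [measurable]: "(\<lambda>\<omega>. \<lambda>i\<in>{1..k}. D i \<omega>) \<in> M \<rightarrow>\<^sub>M (\<Pi>\<^sub>M i\<in>{1..k}. N)"
    using rvD by (auto intro!: measurable_restrict)
  have rvV: "random_variable N (V i)" if "i \<in> {0..k+l}" for i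
    using rvD[of i] U that by (auto simp: V_def)
  have ins: "{0..k+l} = insert 0 {1..k+l}" by auto
  have upd [measurable]: "(\<lambda>(x, X). X(0 := x)) \<in> N \<Otimes>\<^sub>M (\<Pi>\<^sub>M i\<in>{1..k+l}. N) \<rightarrow>\<^sub>M (\<Pi>\<^sub>M i\<in>{0..k+l}. N)"
    unfolding ins by measurable
  have "indep_vars (\<lambda>_. N) V {0..k+l}"
  proof (subst indep_vars_iff_distr_eq_PiM')
    have law: "(\<Pi>\<^sub>M i\<in>{1..k+l}. distr M N (V i)) = distr M (\<Pi>\<^sub>M i\<in>{1..k+l}. N) (\<lambda>\<omega>. \<lambda>i\<in>{1..k+l}. D i \<omega>)"
    proof -
      have "(\<Pi>\<^sub>M i\<in>{1..k+l}. distr M N (V i)) = (\<Pi>\<^sub>M i\<in>{1..k+l}. distr M N (D i))"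
        by (intro PiM_cong) (auto simp: V_def)
      then show ?thesis
        using D rvD l by (subst (asm) indep_vars_iff_distr_eq_PiM') auto
    qed
    have "(\<Pi>\<^sub>M i\<in>{0..k+l}. distr M N (V i)) =
        distr (distr M N (V 0) \<Otimes>\<^sub>M (\<Pi>\<^sub>M i\<in>{1..k+l}. distr M N (V i)))
          (\<Pi>\<^sub>M i\<in>insert 0 {1..k+l}. distr M N (V i)) (\<lambda>(x, X). X(0 := x))"
      unfolding ins
      by (rule distr_pair_PiM_eq_PiM[symmetric]) (auto intro!: prob_space_distr rvV)
    also have "\<dots> = distr (distr M N U \<Otimes>\<^sub>M distr M (\<Pi>\<^sub>M i\<in>{1..k+l}. N) (\<lambda>\<omega>. \<lambda>i\<in>{1..k+l}. D i \<omega>))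
          (\<Pi>\<^sub>M i\<in>{0..k+l}. N) (\<lambda>(x, X). X(0 := x))"
      unfolding law by (intro distr_cong) (auto simp: ins V_def intro!: sets_PiM_cong)
    also have "\<dots> = distr (distr M (N \<Otimes>\<^sub>M (\<Pi>\<^sub>M i\<in>{1..k+l}. N)) (\<lambda>\<omega>. (U \<omega>, \<lambda>i\<in>{1..k+l}. D i \<omega>)))
          (\<Pi>\<^sub>M i\<in>{0..k+l}. N) (\<lambda>(x, X). X(0 := x))"
      by (simp only: UD)
    also have "\<dots> = distr M (\<Pi>\<^sub>M i\<in>{0..k+l}. N) (\<lambda>\<omega>. (\<lambda>i\<in>{1..k+l}. D i \<omega>)(0 := U \<omega>))"
      by (simp only: distr_distr[OF upd measurable_Pair[OF U S]] comp_def case_prod_conv)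
    also have "\<dots> = distr M (\<Pi>\<^sub>M i\<in>{0..k+l}. N) (\<lambda>\<omega>. \<lambda>i\<in>{0..k+l}. V i \<omega>)"
      by (intro distr_cong refl) (auto simp: V_def fun_eq_iff)
    finally show "distr M (\<Pi>\<^sub>M i\<in>{0..k+l}. N) (\<lambda>\<omega>. \<lambda>i\<in>{0..k+l}. V i \<omega>) = (\<Pi>\<^sub>M i\<in>{0..k+l}. distr M N (V i))" ..
  qed (use rvV in auto)
  then have ind: "indep_var (PiM {1..k} (\<lambda>_. N)) (\<lambda>\<omega>. \<lambda>i\<in>{1..k}. V i \<omega>)
      (PiM (insert 0 {k+1..k+l}) (\<lambda>_. N)) (\<lambda>\<omega>. \<lambda>i\<in>insert 0 {k+1..k+l}. V i \<omega>)"
    by (rule indep_var_restrict) auto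
  let ?N1 = "PiM {1..k} (\<lambda>_. N)" and ?N2 = "PiM {k+1..k+l} (\<lambda>_. N)"
    and ?N3 = "PiM (insert 0 {k+1..k+l}) (\<lambda>_. N)"
  let ?S1 = "\<lambda>\<omega>. \<lambda>i\<in>{1..k}. D i \<omega>" and ?S2 = "\<lambda>\<omega>. \<lambda>i\<in>{k+1..k+l}. D i \<omega>"
    and ?S3 = "\<lambda>\<omega>. \<lambda>i\<in>insert 0 {k+1..k+l}. V i \<omega>"
  let ?r = "\<lambda>z. (z 0, restrict z {k+1..k+l})"
  have S3 [measurable]: "?S3 \<in> M \<rightarrow>\<^sub>M ?N3"
    using rvV by (intro measurable_restrict) auto
  have r [measurable]: "?r \<in> ?N3 \<rightarrow>\<^sub>M N \<Otimes>\<^sub>M ?N2"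
    by (intro measurable_Pair measurable_restrict_subset) auto
  have S1V: "(\<lambda>i\<in>{1..k}. V i \<omega>) = ?S1 \<omega>" for \<omega>
    by (auto simp: fun_eq_iff V_def restrict_def)
  have rS3: "?r (?S3 \<omega>) = (U \<omega>, ?S2 \<omega>)" for \<omega>
    by (auto simp: fun_eq_iff V_def restrict_def)
  have law13: "distr M (?N1 \<Otimes>\<^sub>M ?N3) (\<lambda>\<omega>. (?S1 \<omega>, ?S3 \<omega>)) = distr M ?N1 ?S1 \<Otimes>\<^sub>M distr M ?N3 ?S3"
    using ind unfolding indep_var_distribution_eq S1V by (simp only:)
  show "distr M (?N1 \<Otimes>\<^sub>M (N \<Otimes>\<^sub>M ?N2)) (\<lambda>\<omega>. (?S1 \<omega>, (U \<omega>, ?S2 \<omega>)))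
      = distr M ?N1 ?S1 \<Otimes>\<^sub>M distr M (N \<Otimes>\<^sub>M ?N2) (\<lambda>\<omega>. (U \<omega>, ?S2 \<omega>))"
    using distr_Pair_compose[OF S1 S3 r law13] unfolding rS3 .

  let ?t = "\<lambda>z. restrict z {k+1..k+l}"
  have t: "?t \<in> (\<Pi>\<^sub>M i\<in>{1..k+l}. N) \<rightarrow>\<^sub>M ?N2"
    by (intro measurable_restrict_subset) auto
  have "?t (\<lambda>i\<in>{1..k+l}. D i \<omega>) = ?S2 \<omega>" for \<omega>
    by (auto simp: fun_eq_iff restrict_def)
  with distr_Pair_compose[OF U S t UD]
  have "distr M (N \<Otimes>\<^sub>M ?N2) (\<lambda>\<omega>. (U \<omega>, ?S2 \<omega>)) = distr M N U \<Otimes>\<^sub>M distr M ?N2 ?S2"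
    by (simp only:)
  moreover have "distr M ?N2 ?S2 = (\<Pi>\<^sub>M i\<in>{k+1..k+l}. distr M N (D i))"
  proof (subst indep_vars_iff_distr_eq_PiM'[symmetric])
    show "indep_vars (\<lambda>_. N) D {k+1..k+l}" by (rule indep_vars_subset[OF D]) auto
  qed (use rvD l in auto)
  ultimately show "distr M (N \<Otimes>\<^sub>M ?N2) (\<lambda>\<omega>. (U \<omega>, ?S2 \<omega>)) = distr M N U \<Otimes>\<^sub>M (\<Pi>\<^sub>M i\<in>{k+1..k+l}. distr M N (D i))"
    by simp
qed

section \<open>Agreement and vote\<close>

lemma pred_binary_eq:
  assumes "f \<in> N \<rightarrow>\<^sub>M count_space {0, 1::nat}" "g \<in> N \<rightarrow>\<^sub>M count_space {0, 1::nat}"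
  shows "Measurable.pred N (\<lambda>p. f p = g p)"
proof -
  have [measurable]: "(\<lambda>p. real (f p)) \<in> borel_measurable N" "(\<lambda>p. real (g p)) \<in> borel_measurable N"
    using assms[THEN measurable_compose, of real borel] by simp_all
  have "Measurable.pred N (\<lambda>p. real (f p) = real (g p))" by measurable
  then show ?thesis by simp
qed

lemma pred_agree:
  assumes "\<And>m. m \<in> {1..M} \<Longrightarrow> (\<lambda>p. h p m (u p)) \<in> N \<rightarrow>\<^sub>M count_space {0, 1}"
    and "\<And>m. m \<in> {1..M} \<Longrightarrow> (\<lambda>p. h p m (v p)) \<in> N \<rightarrow>\<^sub>M count_space {0, 1}"
  shows "Measurable.pred N (\<lambda>p. agree M \<alpha> (h p) (u p) (v p))"
proof -
  have [measurable]: "Measurable.pred N (\<lambda>p. h p m (u p) = h p m (v p))" if "m \<in> {1..M}" for m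
    using assms that by (intro pred_binary_eq) auto
  show ?thesis unfolding agree_def of_bool_def by measurable
qed

lemma measurable_weighted_vote:
  assumes "\<And>m. m \<in> {1..M} \<Longrightarrow> (\<lambda>p. h p m (u p)) \<in> N \<rightarrow>\<^sub>M count_space {0, 1}"
    and "\<And>m j. m \<in> {1..M} \<Longrightarrow> j \<in> {k+1..k+l} \<Longrightarrow> (\<lambda>p. h p m (fst (z p j))) \<in> N \<rightarrow>\<^sub>M count_space {0, 1}"
    and [measurable]: "\<And>j. j \<in> {k+1..k+l} \<Longrightarrow> (\<lambda>p. real (snd (z p j))) \<in> borel_measurable N"
  shows "(\<lambda>p. weighted_vote M \<alpha> (h p) k l (z p) (u p)) \<in> borel_measurable N"
proof -
  have [measurable]: "Measurable.pred N (\<lambda>p. agree M \<alpha> (h p) (u p) (fst (z p j)))"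
    if "j \<in> {k+1..k+l}" for j
    using assms that by (intro pred_agree) auto
  show ?thesis unfolding weighted_vote_def weight_def of_bool_def by measurable
qed

lemma weighted_vote_cong:
  assumes "\<And>j. j \<in> {k+1..k+l} \<Longrightarrow> z j = z' j"
  shows "weighted_vote M \<alpha> h k l z x = weighted_vote M \<alpha> h k l z' x"
proof -
  have "(\<Sum>i=k+1..k+l. of_bool (agree M \<alpha> h x (fst (z i)))) =
        (\<Sum>i=k+1..k+l. of_bool (agree M \<alpha> h x (fst (z' i))) :: real)"
    using assms by (intro sum.cong) auto
  then show ?thesis
    unfolding weighted_vote_def weight_def using assms by (intro sum.cong) auto
qed

text \<open>
  The normalization of the weights does not affect the decision, which is the sign of a sum with one
  term per observation. This is the form to which Hoeffding's inequality applies.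
\<close>

lemma weighted_vote_gt_half_iff:
  "weighted_vote M \<alpha> h k l z x > 1/2 \<longleftrightarrow>
     (\<Sum>j=k+1..k+l. of_bool (agree M \<alpha> h x (fst (z j))) * (real (snd (z j)) - 1/2)) > 0"
proof -
  let ?a = "\<lambda>j. of_bool (agree M \<alpha> h x (fst (z j))) :: real"
  define N where "N = (\<Sum>j=k+1..k+l. ?a j)"
  have vote: "weighted_vote M \<alpha> h k l z x = (\<Sum>j=k+1..k+l. ?a j * real (snd (z j))) / N"
    unfolding weighted_vote_def weight_def N_def
    by (simp only: sum_divide_distrib times_divide_eq_left)
  have centred: "(\<Sum>j=k+1..k+l. ?a j * (real (snd (z j)) - 1/2))
      = (\<Sum>j=k+1..k+l. ?a j * real (snd (z j))) - N / 2"
    unfolding N_def right_diff_distrib sum_subtractf sum_divide_distrib by simp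
  have "N \<ge> 0" by (auto simp: N_def intro: sum_nonneg)
  show ?thesis
  \<comment> \<open>If nobody agrees with \<open>x\<close>, the vote is \<open>0/0 = 0\<close> and the centred sum is empty, so both sides fail.\<close>
  proof (cases "N = 0")
    case True
    then have "\<forall>j\<in>{k+1..k+l}. ?a j = 0"
      unfolding N_def by (subst (asm) sum_nonneg_eq_0_iff) auto
    then have "(\<Sum>j=k+1..k+l. ?a j * (real (snd (z j)) - 1/2)) = 0"
      by (intro sum.neutral) auto
    then show ?thesis by (simp add: vote True)
  next
    case False
    with \<open>N \<ge> 0\<close> have "N > 0" by simp
    then show ?thesis unfolding vote centred by (simp add: field_simps)
  qed
qed

text \<open>
  Two points where the first \<open>R\<close> classifiers all follow \<open>s\<close> either agree on all of these or on none.
\<close>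

lemma agree_iff_same_class:
  assumes "M \<ge> 1" "\<alpha> < 1/2" "R \<in> {1..M}" "real R \<ge> real M * (1 - \<alpha>)"
    and x: "\<forall>m\<in>{1..R}. h m x = s x" and x': "\<forall>m\<in>{1..R}. h m x' = s x'"
  shows "agree M \<alpha> h x x' \<longleftrightarrow> s x = s x'"
proof -
  let ?c = "\<lambda>m. of_bool (h m x = h m x') :: real"
  have split: "{1..M} = {1..R} \<union> {R+1..M}" using assms(3) by auto
  have sum: "(\<Sum>m=1..M. ?c m) = real R * of_bool (s x = s x') + (\<Sum>m=R+1..M. ?c m)"
    unfolding split by (subst sum.union_disjoint) (use x x' in auto)
  have lo: "(\<Sum>m=R+1..M. ?c m) \<ge> 0" by (intro sum_nonneg) auto
  have "(\<Sum>m=R+1..M. ?c m) \<le> (\<Sum>m=R+1..M. 1)" by (intro sum_mono) auto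
  also have "\<dots> = real M - real R" using assms(3) by (simp add: of_nat_diff)
  finally have hi: "(\<Sum>m=R+1..M. ?c m) \<le> real M - real R" .
  have ag: "agree M \<alpha> h x x' \<longleftrightarrow> real M * (1 - \<alpha>) \<le> (\<Sum>m=1..M. ?c m)"
    using \<open>M \<ge> 1\<close> unfolding agree_def by (simp add: field_simps)
  \<comment> \<open>In the other direction only the \<open>M - R\<close> remaining classifiers can agree, and \<open>\<alpha> < 1 - \<alpha>\<close>.\<close>
  have "real M - real R \<le> real M * \<alpha>" using assms(4) by (simp add: algebra_simps)
  also have "\<dots> < real M * (1 - \<alpha>)" using assms(1,2) by (intro mult_strict_left_mono) auto
  finally show ?thesis unfolding ag sum using lo hi assms(4) by auto
qed

section \<open>Excess risk of the vote for fixed classifiers\<close>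

text \<open>
  \<open>W\<close> is the contribution of one observation to the vote at \<open>x\<close>, signed so that it is positive when
  the observation supports the class \<open>s x\<close>.
\<close>

lemma one_draw_mean_ge:
  fixes Q :: "('a::polish_space \<times> nat) measure"
  assumes MR: "M \<ge> 1" "\<alpha> < 1/2" "R \<in> {1..M}" "real R \<ge> real M * (1 - \<alpha>)"
    and Q: "prob_space Q" and sQ [measurable_cong]: "sets Q = sets obs_space"
    and h [measurable]: "\<And>m. m \<in> {1..M} \<Longrightarrow> h m \<in> borel \<rightarrow>\<^sub>M count_space {0, 1::nat}"
    and s [measurable]: "s \<in> borel \<rightarrow>\<^sub>M count_space {0, 1::nat}"
    and x: "\<forall>m\<in>{1..R}. h m x = s x"
    and gap: "c \<le> measure Q {p \<in> space Q. s (fst p) = s x \<and> snd p = s x}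
                    - measure Q {p \<in> space Q. s (fst p) = s x} / 2"
    and bad: "measure Q {p \<in> space Q. \<exists>m\<in>{1..R}. h m (fst p) \<noteq> s (fst p)} \<le> c"
  defines "W \<equiv> \<lambda>p. of_bool (agree M \<alpha> h x (fst p)) * (of_bool (snd p = s x) - 1/2 :: real)"
  shows "W \<in> borel_measurable Q" "c / 2 \<le> (\<integral>p. W p \<partial>Q)"
proof -
  interpret Q: prob_space Q by fact
  have fstQ [measurable]: "fst \<in> Q \<rightarrow>\<^sub>M borel" and sndQ [measurable]: "snd \<in> Q \<rightarrow>\<^sub>M count_space {0, 1}"
    by (simp_all add: measurable_cong_sets[OF sQ refl] obs_space_def)
  have const: "s x \<in> {0, 1}" using measurable_space[OF s, of x] by simp
  have hQ [measurable]: "(\<lambda>p. h m (fst p)) \<in> Q \<rightarrow>\<^sub>M count_space {0, 1}" if "m \<in> {1..M}" for m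
    using measurable_compose[OF fstQ h[OF that]] .
  have sfst [measurable]: "(\<lambda>p. s (fst p)) \<in> Q \<rightarrow>\<^sub>M count_space {0, 1}"
    using measurable_compose[OF fstQ s] .
  have [measurable]: "Measurable.pred Q (\<lambda>p. agree M \<alpha> h x (fst p))"
    using hQ measurable_space[OF h, of _ x] by (intro pred_agree) auto
  have [measurable]: "Measurable.pred Q (\<lambda>p. snd p = s x)" "Measurable.pred Q (\<lambda>p. s (fst p) = s x)"
    using const by (auto intro!: pred_binary_eq sfst sndQ)
  have [measurable]: "Measurable.pred Q (\<lambda>p. h m (fst p) = s (fst p))" if "m \<in> {1..R}" for m
    using that MR(3) by (intro pred_binary_eq hQ sfst) auto
  show Wm [measurable]: "W \<in> borel_measurable Q"
    unfolding W_def of_bool_def by measurable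
  \<comment> \<open>\<open>T\<close> and \<open>S\<close> give the mean when agreement is exactly equality of classes; passing to \<open>W\<close> changes the integrand only on \<open>B\<close>, by at most 1/2.\<close>
  define B where "B = {p \<in> space Q. \<exists>m\<in>{1..R}. h m (fst p) \<noteq> s (fst p)}"
  define S where "S = {p \<in> space Q. s (fst p) = s x}"
  define T where "T = {p \<in> space Q. s (fst p) = s x \<and> snd p = s x}"
  have [measurable]: "B \<in> sets Q" "S \<in> sets Q" "T \<in> sets Q"
    unfolding B_def S_def T_def by measurable
  have "c / 2 \<le> measure Q T - measure Q S / 2 - measure Q B / 2"
    using gap bad unfolding B_def S_def T_def by simp
  also have "\<dots> = (\<integral>p. indicator T p - indicator S p / 2 - indicator B p / 2 \<partial>Q)"
    by (simp add: Q.emeasure_eq_measure)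
  also have "\<dots> \<le> (\<integral>p. W p \<partial>Q)"
  proof (rule integral_mono)
    show "integrable Q W"
      by (rule Q.integrable_const_bound[of _ "1/2"]) (auto simp: W_def)
    fix p assume p: "p \<in> space Q"
    show "indicator T p - indicator S p / 2 - indicator B p / 2 \<le> W p"
    proof (cases "p \<in> B")
      case True
      then show ?thesis using p by (auto simp: W_def S_def T_def indicator_def)
    next
      case False
      then have "agree M \<alpha> h x (fst p) \<longleftrightarrow> s x = s (fst p)"
        using p x by (intro agree_iff_same_class[OF MR]) (auto simp: B_def)
      then show ?thesis using p False by (auto simp: W_def S_def T_def indicator_def)
    qed
  qed (simp add: Q.emeasure_eq_measure)
  finally show "c / 2 \<le> (\<integral>p. W p \<partial>Q)" .
qed

lemma iid_sum_nonpos_tail: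
  assumes Q: "prob_space Q" and W [measurable]: "W \<in> borel_measurable Q"
    and bd: "\<And>p. p \<in> space Q \<Longrightarrow> W p \<in> {-1/2..1/2}"
    and mean: "c / 2 \<le> (\<integral>p. W p \<partial>Q)" "0 \<le> c" and I: "finite I"
  shows "measure (\<Pi>\<^sub>M i\<in>I. Q) {z \<in> space (\<Pi>\<^sub>M i\<in>I. Q). (\<Sum>i\<in>I. W (z i)) \<le> 0}
           \<le> exp (- (c\<^sup>2 / 2) * real (card I))"
proof (cases "I = {}")
  case True
  interpret prob_space "\<Pi>\<^sub>M i\<in>I. Q" by (intro prob_space_PiM Q)
  show ?thesis by (rule order.trans[OF prob_le_1]) (simp add: True)
next
  case False
  interpret Q: prob_space Q by fact
  interpret P: prob_space "\<Pi>\<^sub>M i\<in>I. Q" by (intro prob_space_PiM Q)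
  have coord: "distr (\<Pi>\<^sub>M i\<in>I. Q) Q (\<lambda>z. z i) = Q" if "i \<in> I" for i
    using that Q by (intro distr_PiM_component) auto
  have ind: "P.indep_vars (\<lambda>_. Q) (\<lambda>i z. z i) I"
  proof (subst P.indep_vars_iff_distr_eq_PiM')
    have "distr (\<Pi>\<^sub>M i\<in>I. Q) (\<Pi>\<^sub>M i\<in>I. Q) (\<lambda>z. restrict z I) = distr (\<Pi>\<^sub>M i\<in>I. Q) (\<Pi>\<^sub>M i\<in>I. Q) (\<lambda>z. z)"
      by (intro distr_cong) (auto simp: space_PiM PiE_restrict)
    also have "\<dots> = (\<Pi>\<^sub>M i\<in>I. Q)" by (simp add: distr_id)
    also have "\<dots> = (\<Pi>\<^sub>M i\<in>I. distr (\<Pi>\<^sub>M i\<in>I. Q) Q (\<lambda>z. z i))"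
      by (intro PiM_cong refl coord[symmetric])
    finally show "distr (\<Pi>\<^sub>M i\<in>I. Q) (\<Pi>\<^sub>M i\<in>I. Q) (\<lambda>z. \<lambda>i\<in>I. z i) = (\<Pi>\<^sub>M i\<in>I. distr (\<Pi>\<^sub>M i\<in>I. Q) Q (\<lambda>z. z i))" .
  qed (use False in auto)
  have indW: "P.indep_vars (\<lambda>_. borel) (\<lambda>i z. W (z i)) I"
    by (rule P.indep_vars_compose2[OF ind]) measurable
  have EW: "P.expectation (\<lambda>z. W (z i)) = (\<integral>p. W p \<partial>Q)" if "i \<in> I" for i
    using that by (subst (2) coord[OF that, symmetric], subst integral_distr) auto
  define \<mu> where "\<mu> = (\<Sum>i\<in>I. P.expectation (\<lambda>z. W (z i)))"
  have \<mu>: "\<mu> = real (card I) * (\<integral>p. W p \<partial>Q)" by (simp add: \<mu>_def EW)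
  interpret H: Hoeffding_ineq "\<Pi>\<^sub>M i\<in>I. Q" I "\<lambda>i z. W (z i)" "\<lambda>_. -1/2" "\<lambda>_. 1/2" \<mu>
  proof unfold_locales
    fix i assume "i \<in> I"
    then show "AE z in \<Pi>\<^sub>M i\<in>I. Q. W (z i) \<in> {-1/2..1/2}"
      by (intro AE_I2 bd) (auto simp: space_PiM)
  qed (use I indW in \<open>auto simp: \<mu>_def\<close>)
  have n: "real (card I) > 0" using False I by (simp add: card_gt_0_iff)
  have "\<mu> \<ge> real (card I) * (c / 2)" unfolding \<mu> using mean(1) by (intro mult_left_mono) auto
  moreover have "0 \<le> real (card I) * (c / 2)" using mean(2) by simp
  ultimately have \<mu>c: "(real (card I) * (c / 2))\<^sup>2 \<le> \<mu>\<^sup>2" and \<mu>0: "\<mu> \<ge> 0" by (auto intro: power_mono)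
  \<comment> \<open>The deviation below the mean is the whole mean \<open>\<mu> \<ge> |I| c / 2\<close>; each summand has range 1.\<close>
  have "P.prob {z \<in> space (\<Pi>\<^sub>M i\<in>I. Q). (\<Sum>i\<in>I. W (z i)) \<le> \<mu> - \<mu>} \<le> exp (-2 * \<mu>\<^sup>2 / (\<Sum>i\<in>I. (1/2 - - 1/2)\<^sup>2))"
    by (rule H.Hoeffding_ineq_le[OF \<mu>0]) (use n in simp)
  also have "\<dots> \<le> exp (- (c\<^sup>2 / 2) * real (card I))"
    using n \<mu>c by (simp add: field_simps power2_eq_square)
  finally show ?thesis by simp
qed

text \<open>
  The two risks differ by at most the probability that the vote departs from \<open>s\<close>, which happens
  on the bad set or by an unlucky voting sample. Adding \<open>1/c\<close> to the factor lets the bound hold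
  without a smallness condition on the errors.
\<close>

lemma vote_excess_risk_bound:
  fixes Q :: "('a::polish_space \<times> nat) measure"
    and k l :: nat
  assumes MR: "M \<ge> 1" "\<alpha> < 1/2" "R \<in> {1..M}" "real R \<ge> real M * (1 - \<alpha>)"
    and Q: "prob_space Q" and sQ [measurable_cong]: "sets Q = sets obs_space"
    and h: "\<And>m. m \<in> {1..M} \<Longrightarrow> h m \<in> borel \<rightarrow>\<^sub>M count_space {0, 1::nat}"
    and s: "s \<in> borel \<rightarrow>\<^sub>M count_space {0, 1::nat}"
    and gap: "\<And>v. v \<in> {0, 1} \<Longrightarrow> c \<le> measure Q {p \<in> space Q. s (fst p) = v \<and> snd p = v}
                    - measure Q {p \<in> space Q. s (fst p) = v} / 2"
    and c: "c > 0"
  defines "rule \<equiv> \<lambda>z x. if weighted_vote M \<alpha> h k l z x > 1/2 then 1 else 0 :: nat"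
  defines "N \<equiv> Q \<Otimes>\<^sub>M (\<Pi>\<^sub>M i\<in>{k+1..k+l}. Q)"
  shows "\<bar>measure N {(p, z) \<in> space N. rule z (fst p) \<noteq> snd p}
            - measure Q {p \<in> space Q. s (fst p) \<noteq> snd p}\<bar>
       \<le> (1 + 1/c) * (\<Sum>m=1..R. measure Q {p \<in> space Q. h m (fst p) \<noteq> s (fst p)})
          + exp (- (c\<^sup>2 / 2) * real l)"
proof -
  let ?Z = "\<Pi>\<^sub>M i\<in>{k+1..k+l}. Q"
  interpret Q: prob_space Q by fact
  interpret Z: prob_space ?Z by (intro prob_space_PiM Q)
  interpret QZ: pair_prob_space Q ?Z ..
  interpret N: prob_space N unfolding N_def by (rule QZ.prob_space_axioms)
  have fstQ: "fst \<in> Q \<rightarrow>\<^sub>M borel" and sndQ: "snd \<in> Q \<rightarrow>\<^sub>M count_space {0, 1}"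
    by (simp_all add: measurable_cong_sets[OF sQ refl] obs_space_def)
  have sfst: "(\<lambda>p. s (fst p)) \<in> Q \<rightarrow>\<^sub>M count_space {0, 1}"
    using measurable_compose[OF fstQ s] .
  have hfst: "(\<lambda>p. h m (fst p)) \<in> Q \<rightarrow>\<^sub>M count_space {0, 1}" if "m \<in> {1..M}" for m
    using measurable_compose[OF fstQ h[OF that]] .
  have fstN [measurable]: "fst \<in> N \<rightarrow>\<^sub>M Q" by (simp add: N_def)
  have coordN [measurable]: "(\<lambda>q. snd q j) \<in> N \<rightarrow>\<^sub>M Q" if "j \<in> {k+1..k+l}" for j
    using that by (simp add: N_def)
  have [measurable]: "(\<lambda>q. weighted_vote M \<alpha> h k l (snd q) (fst (fst q))) \<in> borel_measurable N"
    by (intro measurable_weighted_vote measurable_compose[OF fstN hfst]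
        measurable_compose[OF coordN hfst] measurable_compose[OF coordN measurable_compose[OF sndQ]])
      auto
  have ruleN: "(\<lambda>q. rule (snd q) (fst (fst q))) \<in> N \<rightarrow>\<^sub>M count_space {0, 1}"
    unfolding rule_def by measurable
  have [measurable]: "Measurable.pred N (\<lambda>q. rule (snd q) (fst (fst q)) = s (fst (fst q)))"
    "Measurable.pred N (\<lambda>q. rule (snd q) (fst (fst q)) = snd (fst q))"
    by (intro pred_binary_eq ruleN measurable_compose[OF fstN sfst] measurable_compose[OF fstN sndQ])+
  have [measurable]: "Measurable.pred Q (\<lambda>p. s (fst p) = snd p)"
    by (intro pred_binary_eq sfst sndQ)
  have [measurable]: "Measurable.pred Q (\<lambda>p. h m (fst p) = s (fst p))" if "m \<in> {1..R}" for m
    using that MR(3) by (intro pred_binary_eq hfst sfst) auto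
  define err where "err m = {p \<in> space Q. h m (fst p) \<noteq> s (fst p)}" for m
  define B where "B = {p \<in> space Q. \<exists>m\<in>{1..R}. h m (fst p) \<noteq> s (fst p)}"
  have err [measurable]: "err m \<in> sets Q" if "m \<in> {1..R}" for m
    unfolding err_def using that by measurable
  have [measurable]: "B \<in> sets Q" unfolding B_def by measurable
  define \<sigma> where "\<sigma> = (\<Sum>m=1..R. measure Q (err m))"
  have \<sigma>0: "\<sigma> \<ge> 0" unfolding \<sigma>_def by (intro sum_nonneg) auto
  have B_le: "measure Q B \<le> \<sigma>"
  proof -
    have "B = (\<Union>m\<in>{1..R}. err m)" by (auto simp: B_def err_def)
    then show ?thesis unfolding \<sigma>_def using err
      by (auto intro!: Q.finite_measure_subadditive_finite)
  qed
  have lift: "measure N {q \<in> space N. fst q \<in> A} = measure Q A" if [measurable]: "A \<in> sets Q" for A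
  proof -
    have "{q \<in> space N. fst q \<in> A} = A \<times> space ?Z"
      using sets.sets_into_space[OF that] by (auto simp: N_def space_pair_measure)
    then show ?thesis
      by (simp only: measure_def N_def Z.emeasure_pair_measure_Times[OF that sets.top]
          Z.emeasure_space_1 mult_1_right)
  qed
  define E where "E = {q \<in> space N. rule (snd q) (fst (fst q)) \<noteq> snd (fst q)}"
  define E' where "E' = {q \<in> space N. s (fst (fst q)) \<noteq> snd (fst q)}"
  define F where "F = {q \<in> space N. rule (snd q) (fst (fst q)) \<noteq> s (fst (fst q))}"
  have [measurable]: "E \<in> sets N" "E' \<in> sets N" "F \<in> sets N"
    unfolding E_def E'_def F_def by measurable
  have E': "measure N E' = measure Q {p \<in> space Q. s (fst p) \<noteq> snd p}"
  proof -
    have "E' = {q \<in> space N. fst q \<in> {p \<in> space Q. s (fst p) \<noteq> snd p}}"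
      by (auto simp: E'_def N_def space_pair_measure)
    then show ?thesis by (simp only:) (rule lift, measurable)
  qed
  have "\<bar>measure N E - measure N E'\<bar> \<le> (1 + 1/c) * \<sigma> + exp (- (c\<^sup>2 / 2) * real l)"
  \<comment> \<open>A large set \<open>B\<close> makes the bound trivial: the risks differ by at most \<open>1 \<le> \<sigma> / c\<close>.\<close>
  proof (cases "measure Q B \<le> c")
    case False
    have "\<bar>measure N E - measure N E'\<bar> \<le> 1"
      using N.prob_le_1[of E] N.prob_le_1[of E'] measure_nonneg[of N E] measure_nonneg[of N E'] by linarith
    also have "\<dots> \<le> 1/c * \<sigma>" using False B_le c by (simp add: field_simps)
    also have "\<dots> \<le> (1 + 1/c) * \<sigma>" using \<sigma>0 by (simp add: algebra_simps)
    finally show ?thesis by (smt (verit) exp_ge_zero)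
  next
    case True
    \<comment> \<open>The observations are drawn independently of the query point, so the query point can be frozen by Fubini.\<close>
    have tail: "measure ?Z {z \<in> space ?Z. rule z (fst p) \<noteq> s (fst p)} \<le> exp (- (c\<^sup>2 / 2) * real l)"
      if p: "p \<in> space Q" "p \<notin> B" for p
    proof -
      let ?x = "fst p"
      \<comment> \<open>The sign is such that a wrong vote means that the sum of \<open>W\<close> is not positive, whichever class \<open>s\<close> assigns.\<close>
      define W where "W = (\<lambda>p'. of_bool (agree M \<alpha> h ?x (fst p')) * (of_bool (snd p' = s ?x) - 1/2 :: real))"
      have v: "s ?x \<in> {0, 1}" using measurable_space[OF s, of ?x] by simp
      have W: "W \<in> borel_measurable Q" "c / 2 \<le> (\<integral>p. W p \<partial>Q)"
        using one_draw_mean_ge[OF MR Q sQ h s _ gap[OF v] True[unfolded B_def]] p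
        unfolding W_def B_def by auto
      have "measure ?Z {z \<in> space ?Z. rule z ?x \<noteq> s ?x}
          \<le> measure ?Z {z \<in> space ?Z. (\<Sum>j\<in>{k+1..k+l}. W (z j)) \<le> 0}"
      proof (rule Z.finite_measure_mono)
        note [measurable] = W(1)
        show "{z \<in> space ?Z. (\<Sum>j\<in>{k+1..k+l}. W (z j)) \<le> 0} \<in> Z.events" by measurable
        show "{z \<in> space ?Z. rule z ?x \<noteq> s ?x} \<subseteq> {z \<in> space ?Z. (\<Sum>j\<in>{k+1..k+l}. W (z j)) \<le> 0}"
        proof safe
          fix z assume z: "z \<in> space ?Z" and wrong: "rule z ?x \<noteq> s ?x"
          have lab: "snd (z j) \<in> {0, 1}" if "j \<in> {k+1..k+l}" for j
          proof -
            have "z j \<in> space Q" using PiE_mem[OF z[unfolded space_PiM] that] .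
            from measurable_space[OF sndQ this] show ?thesis by simp
          qed
          let ?S = "\<Sum>j=k+1..k+l. of_bool (agree M \<alpha> h ?x (fst (z j))) * (real (snd (z j)) - 1/2)"
          show "(\<Sum>j\<in>{k+1..k+l}. W (z j)) \<le> 0"
          proof (cases "s ?x = 1")
            case True
            then have "(\<Sum>j\<in>{k+1..k+l}. W (z j)) = ?S"
              unfolding W_def using lab by (intro sum.cong refl) force
            also have "?S \<le> 0"
              using wrong True weighted_vote_gt_half_iff[of M \<alpha> h k l z ?x]
              by (auto simp: rule_def split: if_splits)
            finally show ?thesis .
          next
            case False
            with v have 0: "s ?x = 0" by simp
            then have "(\<Sum>j\<in>{k+1..k+l}. W (z j)) = - ?S"
              unfolding W_def sum_negf[symmetric] using lab by (intro sum.cong refl) force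
            also have "- ?S \<le> 0"
              using wrong 0 weighted_vote_gt_half_iff[of M \<alpha> h k l z ?x]
              by (auto simp: rule_def split: if_splits)
            finally show ?thesis .
          qed
        qed
      qed
      also have "\<dots> \<le> exp (- (c\<^sup>2 / 2) * real (card {k+1..k+l}))"
        using c by (intro iid_sum_nonpos_tail Q W) (auto simp: W_def)
      finally show ?thesis by simp
    qed
    have "F \<subseteq> {q \<in> space N. fst q \<in> B} \<union> {q \<in> F. fst q \<notin> B}" by (auto simp: F_def)
    then have "measure N F \<le> measure N ({q \<in> space N. fst q \<in> B} \<union> {q \<in> F. fst q \<notin> B})"
      by (intro N.finite_measure_mono) measurable
    also have "\<dots> \<le> measure N {q \<in> space N. fst q \<in> B} + measure N {q \<in> F. fst q \<notin> B}"
      by (intro measure_Un_le) measurable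
    also have "measure N {q \<in> F. fst q \<notin> B} \<le> exp (- (c\<^sup>2 / 2) * real l)"
    proof -
      define G where "G = {q \<in> F. fst q \<notin> B}"
      have G [measurable]: "G \<in> sets (Q \<Otimes>\<^sub>M ?Z)"
        unfolding G_def N_def[symmetric] by measurable
      have "emeasure N G = (\<integral>\<^sup>+p. emeasure ?Z (Pair p -` G) \<partial>Q)"
        unfolding N_def by (rule Z.emeasure_pair_measure_alt[OF G])
      also have "\<dots> \<le> (\<integral>\<^sup>+p. ennreal (exp (- (c\<^sup>2 / 2) * real l)) \<partial>Q)"
      proof (rule nn_integral_mono)
        fix p assume p: "p \<in> space Q"
        show "emeasure ?Z (Pair p -` G) \<le> ennreal (exp (- (c\<^sup>2 / 2) * real l))"
        proof (cases "p \<in> B")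
          case True
          then have "Pair p -` G = {}" by (auto simp: G_def)
          then show ?thesis by simp
        next
          case False
          then have "Pair p -` G = {z \<in> space ?Z. rule z (fst p) \<noteq> s (fst p)}"
            using p by (auto simp: G_def F_def N_def space_pair_measure)
          then show ?thesis
            using tail[OF p False] by (simp only: Z.emeasure_eq_measure ennreal_leI)
        qed
      qed
      also have "\<dots> = ennreal (exp (- (c\<^sup>2 / 2) * real l))" by (simp add: Q.emeasure_space_1)
      finally show ?thesis unfolding G_def[symmetric] by (simp add: N.emeasure_eq_measure)
    qed
    finally have F_le: "measure N F \<le> \<sigma> + exp (- (c\<^sup>2 / 2) * real l)"
      using B_le lift[of B] by simp
    \<comment> \<open>The rules \<open>rule\<close> and \<open>s\<close> err on the same points outside \<open>F\<close>.\<close>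
    have "measure N E \<le> measure N (E' \<union> F)" "measure N E' \<le> measure N (E \<union> F)"
      by (intro N.finite_measure_mono; measurable?; auto simp: E_def E'_def F_def)+
    moreover have "measure N (E' \<union> F) \<le> measure N E' + measure N F"
      "measure N (E \<union> F) \<le> measure N E + measure N F"
      by (intro measure_Un_le; measurable)+
    ultimately have "\<bar>measure N E - measure N E'\<bar> \<le> measure N F" by linarith
    also note F_le
    also have "\<sigma> \<le> (1 + 1/c) * \<sigma>" using \<sigma>0 c by (simp add: algebra_simps)
    finally show ?thesis by simp
  qed
  moreover have "{(p, z) \<in> space N. rule z (fst p) \<noteq> snd p} = E"
    by (auto simp: E_def)
  ultimately show ?thesis unfolding E' \<sigma>_def err_def by simp
qed

section \<open>Excess risk given the training sample\<close>

lemma measurable_bayes_rule: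
  "\<eta> \<in> borel_measurable borel \<Longrightarrow> bayes_rule \<eta> \<in> borel \<rightarrow>\<^sub>M count_space {0, 1}"
  unfolding bayes_rule_def[abs_def] by measurable

text \<open>
  Given \<open>D\<^sub>k\<close>, the classifiers are fixed, the point to be classified together with its label has law
  \<open>Q\<close>, and the voting sample is an independent iid sample from \<open>Q\<close>; thus the bound for fixed
  classifiers applies at almost every realization. There are only countably many pairs \<open>(k, l)\<close>, so
  one null set serves for all of them.
\<close>

lemma aggregated_excess_risk_bound:
  fixes P :: "'w measure"
    and X :: "'w \<Rightarrow> 'a::polish_space" and Y :: "'w \<Rightarrow> nat"
    and D :: "nat \<Rightarrow> 'w \<Rightarrow> 'a \<times> nat"
    and \<eta> :: "'a \<Rightarrow> real"
    and g :: "nat \<Rightarrow> nat \<Rightarrow> (nat \<Rightarrow> 'a \<times> nat) \<Rightarrow> 'a \<Rightarrow> nat"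
    and M R :: nat and \<alpha> :: real
  assumes P: "prob_space P"
    and X [measurable]: "X \<in> P \<rightarrow>\<^sub>M borel" and Y [measurable]: "Y \<in> P \<rightarrow>\<^sub>M count_space {0, 1}"
    and \<eta>: "\<eta> \<in> borel_measurable borel"
    and D: "prob_space.indep_vars P (\<lambda>_. obs_space) D {1..}"
    and iid: "\<forall>i\<ge>1. distr P obs_space (D i) = distr P obs_space (\<lambda>\<omega>. (X \<omega>, Y \<omega>))"
    and fresh: "\<forall>n. prob_space.indep_set P
               (sets (vimage_algebra (space P) (\<lambda>\<omega>. (X \<omega>, Y \<omega>)) obs_space))
               (sets (vimage_algebra (space P) (first_sample D n) (\<Pi>\<^sub>M i\<in>{1..n}. obs_space)))"
    and g: "\<forall>m\<in>{1..M}. \<forall>k\<ge>1. (\<lambda>(d, x). g m k d x)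
               \<in> (\<Pi>\<^sub>M i\<in>{1..k}. obs_space) \<Otimes>\<^sub>M borel \<rightarrow>\<^sub>M count_space {0, 1}"
    and MR: "M \<ge> 1" "\<alpha> < 1/2" "R \<in> {1..M}" "real R \<ge> real M * (1 - \<alpha>)"
    and gap1: "\<P>(\<omega> in P. Y \<omega> = 1 \<bar> bayes_rule \<eta> (X \<omega>) = 1) > 1/2"
    and gap0: "\<P>(\<omega> in P. Y \<omega> = 0 \<bar> bayes_rule \<eta> (X \<omega>) = 0) > 1/2"
  obtains K C where "K \<ge> 0" "C > 0"
    "AE \<omega> in P. \<forall>k\<ge>1. \<forall>l\<ge>1.
       \<bar>aggregated_risk P X Y D M \<alpha> g k l \<omega> - bayes_risk P X Y \<eta>\<bar>
         \<le> K * (\<Sum>m=1..R. classifier_error P X D \<eta> g m k \<omega>) + exp (- C * real l)"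
proof -
  interpret prob_space P by fact
  define U where "U = (\<lambda>\<omega>. (X \<omega>, Y \<omega>))"
  define Q where "Q = distr P obs_space U"
  define s where "s = bayes_rule \<eta>"
  have U [measurable]: "U \<in> P \<rightarrow>\<^sub>M obs_space" unfolding U_def obs_space_def by measurable
  have s: "s \<in> borel \<rightarrow>\<^sub>M count_space {0, 1}" unfolding s_def by (rule measurable_bayes_rule[OF \<eta>])
  have Dm [measurable]: "D i \<in> P \<rightarrow>\<^sub>M obs_space" if "i \<ge> 1" for i
    using D that by (auto simp: indep_vars_def)
  have Sm: "first_sample D k \<in> P \<rightarrow>\<^sub>M (\<Pi>\<^sub>M i\<in>{1..k}. obs_space)" for k
    unfolding first_sample_def[abs_def] by (intro measurable_restrict Dm) auto
  have Q: "prob_space Q" unfolding Q_def by (rule prob_space_distr[OF U])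
  have sQ [measurable_cong]: "sets Q = sets obs_space" by (simp add: Q_def)
  have fsto: "fst \<in> obs_space \<rightarrow>\<^sub>M (borel :: 'a measure)"
    and sndo: "snd \<in> (obs_space :: ('a \<times> nat) measure) \<rightarrow>\<^sub>M count_space {0, 1}"
    by (simp_all add: obs_space_def)
  note sfst = measurable_compose[OF fsto s]
  have const: "(\<lambda>_. v) \<in> N \<rightarrow>\<^sub>M count_space {0, 1}" if "v \<in> {0, 1}" for v :: nat and N :: "('a \<times> nat) measure"
    using that by simp
  have measureQ: "measure Q {p \<in> space Q. A p} = \<P>(\<omega> in P. A (U \<omega>))"
    if A [measurable]: "Measurable.pred obs_space A" for A
  proof -
    have "{p \<in> space Q. A p} \<in> sets obs_space" by (simp add: Q_def)
    then show ?thesis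
      unfolding Q_def using measurable_space[OF U]
      by (subst measure_distr) (auto intro!: arg_cong[where f = "measure P"])
  qed

  \<comment> \<open>\<open>gap v\<close> is \<open>E[1{s(X) = v} (1{Y = v} - 1/2)]\<close>, the unnormalized form of the hypotheses \<open>gap1\<close> and \<open>gap0\<close>.\<close>
  define gap where "gap v = measure Q {p \<in> space Q. s (fst p) = v \<and> snd p = v}
                    - measure Q {p \<in> space Q. s (fst p) = v} / 2" for v
  have gap_pos: "gap v > 0" if v: "v \<in> {0, 1}" and cp: "\<P>(\<omega> in P. Y \<omega> = v \<bar> s (X \<omega>) = v) > 1/2" for v
  proof -
    have [measurable]: "Measurable.pred obs_space (\<lambda>p. s (fst p) = v)"
      "Measurable.pred (obs_space :: ('a \<times> nat) measure) (\<lambda>p. snd p = v)"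
      by (intro pred_binary_eq sfst sndo const v)+
    have a: "measure Q {p \<in> space Q. s (fst p) = v \<and> snd p = v} = \<P>(\<omega> in P. Y \<omega> = v \<and> s (X \<omega>) = v)"
      by (subst measureQ) (auto simp: U_def conj_commute)
    have b: "measure Q {p \<in> space Q. s (fst p) = v} = \<P>(\<omega> in P. s (X \<omega>) = v)"
      by (subst measureQ) (auto simp: U_def)
    \<comment> \<open>A conditional probability on a null event is \<open>0/0 = 0\<close>, so the class \<open>v\<close> has positive probability.\<close>
    have "\<P>(\<omega> in P. s (X \<omega>) = v) \<noteq> 0" using cp by (auto simp: cond_prob_def)
    then have "\<P>(\<omega> in P. s (X \<omega>) = v) > 0" using measure_nonneg[of P] by (simp add: less_le)
    then show ?thesis using cp unfolding gap_def a b cond_prob_def by (simp add: field_simps)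
  qed
  define c where "c = min (gap 0) (gap 1)"
  have c: "c > 0" using gap_pos[of 0] gap_pos[of 1] gap0 gap1 by (auto simp: c_def s_def)
  have gap_ge: "c \<le> measure Q {p \<in> space Q. s (fst p) = v \<and> snd p = v}
      - measure Q {p \<in> space Q. s (fst p) = v} / 2" if "v \<in> {0, 1}" for v
    using that unfolding gap_def[symmetric] c_def by auto

  have bayes: "bayes_risk P X Y \<eta> = measure Q {p \<in> space Q. s (fst p) \<noteq> snd p}"
  proof -
    have [measurable]: "Measurable.pred obs_space (\<lambda>p. s (fst p) = snd p)"
      by (intro pred_binary_eq sfst sndo)
    show ?thesis unfolding bayes_risk_def s_def[symmetric]
      by (subst measureQ) (auto simp: U_def)
  qed

  define err where "err m k d = measure Q {p \<in> space Q. g m k d (fst p) \<noteq> s (fst p)}" for m k d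
  let ?O = "obs_space :: ('a \<times> nat) measure"
  have error: "AE \<omega> in P. classifier_error P X D \<eta> g m k \<omega> = err m k (first_sample D k \<omega>)"
    if m: "m \<in> {1..M}" and k: "k \<ge> 1" for m k
  proof -
    let ?N = "\<Pi>\<^sub>M i\<in>{1..k}. ?O"
    have "indep_set (sets (vimage_algebra (space P) (first_sample D k) ?N))
        (sets (vimage_algebra (space P) U ?O))"
      using fresh[rule_format, of k] unfolding U_def[symmetric] by (rule indep_set_commute)
    from distr_Pair_eq_if_indep_set[OF Sm U this]
    have law: "distr P (?N \<Otimes>\<^sub>M ?O) (\<lambda>\<omega>. (first_sample D k \<omega>, U \<omega>))
        = distr P ?N (first_sample D k) \<Otimes>\<^sub>M distr P ?O U" .
    have [measurable]: "Measurable.pred (?N \<Otimes>\<^sub>M ?O) (\<lambda>q. g m k (fst q) (fst (snd q)) = s (fst (snd q)))"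
    proof (rule pred_binary_eq)
      have "(\<lambda>q. (fst q, fst (snd q))) \<in> ?N \<Otimes>\<^sub>M ?O \<rightarrow>\<^sub>M ?N \<Otimes>\<^sub>M borel"
        by (intro measurable_Pair measurable_fst measurable_compose[OF measurable_snd fsto])
      from measurable_compose[OF this g[rule_format, OF m k]]
      show "(\<lambda>q. g m k (fst q) (fst (snd q))) \<in> ?N \<Otimes>\<^sub>M ?O \<rightarrow>\<^sub>M count_space {0, 1}" by simp
    qed (rule measurable_compose[OF measurable_snd sfst])
    have "AE \<omega> in P. real_cond_exp P (vimage_algebra (space P) (first_sample D k) ?N)
        (indicator {\<omega> \<in> space P. g m k (first_sample D k \<omega>) (fst (U \<omega>)) \<noteq> s (fst (U \<omega>))}) \<omega>
      = measure (distr P ?O U) {z \<in> space (distr P ?O U).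
          g m k (first_sample D k \<omega>) (fst z) \<noteq> s (fst z)}"
      by (rule real_cond_exp_indicator_indep[OF P Sm U law]) measurable
    then show ?thesis
      unfolding classifier_error_def prob_given_first_def err_def Q_def s_def[symmetric]
      by (simp add: U_def)
  qed

  define rule where "rule k l d z x = (if weighted_vote M \<alpha> (\<lambda>m. g m k d) k l z x > 1/2 then 1 else 0 :: nat)"
    for k l d z x
  define risk where "risk k l d = measure (Q \<Otimes>\<^sub>M (\<Pi>\<^sub>M i\<in>{k+1..k+l}. Q))
      {(p, z) \<in> space (Q \<Otimes>\<^sub>M (\<Pi>\<^sub>M i\<in>{k+1..k+l}. Q)). rule k l d z (fst p) \<noteq> snd p}" for k l d
  have agg: "AE \<omega> in P. aggregated_risk P X Y D M \<alpha> g k l \<omega> = risk k l (first_sample D k \<omega>)"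
    if k: "k \<ge> 1" and l: "l \<ge> 1" for k l
  proof -
    let ?N = "\<Pi>\<^sub>M i\<in>{1..k}. ?O"
    let ?NE = "\<Pi>\<^sub>M i\<in>{k+1..k+l}. ?O"
    let ?Z = "\<lambda>\<omega>. (U \<omega>, \<lambda>i\<in>{k+1..k+l}. D i \<omega>)"
    have Z: "?Z \<in> P \<rightarrow>\<^sub>M ?O \<Otimes>\<^sub>M ?NE"
      by (intro measurable_Pair U measurable_restrict Dm) auto
    have D': "indep_vars (\<lambda>_. ?O) D {1..k+l}"
      by (rule indep_vars_subset[OF D]) auto
    have UD: "distr P (?O \<Otimes>\<^sub>M (\<Pi>\<^sub>M i\<in>{1..k+l}. ?O)) (\<lambda>\<omega>. (U \<omega>, first_sample D (k+l) \<omega>))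
        = distr P ?O U \<Otimes>\<^sub>M distr P (\<Pi>\<^sub>M i\<in>{1..k+l}. ?O) (first_sample D (k+l))"
      using fresh unfolding U_def[symmetric] by (intro distr_Pair_eq_if_indep_set[OF U Sm]) auto
    note laws = distr_past_and_fresh[OF U UD[unfolded first_sample_def] D' l]
    have law: "distr P (?N \<Otimes>\<^sub>M (?O \<Otimes>\<^sub>M ?NE)) (\<lambda>\<omega>. (first_sample D k \<omega>, ?Z \<omega>))
        = distr P ?N (first_sample D k) \<Otimes>\<^sub>M distr P (?O \<Otimes>\<^sub>M ?NE) ?Z"
      using laws(1) unfolding first_sample_def .
    have lawZ: "distr P (?O \<Otimes>\<^sub>M ?NE) ?Z = Q \<Otimes>\<^sub>M (\<Pi>\<^sub>M i\<in>{k+1..k+l}. Q)"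
    proof -
      have "(\<Pi>\<^sub>M i\<in>{k+1..k+l}. distr P ?O (D i)) = (\<Pi>\<^sub>M i\<in>{k+1..k+l}. Q)"
        by (intro PiM_cong refl) (simp add: Q_def U_def iid)
      then show ?thesis using laws(2) by (simp only: Q_def)
    qed
    let ?NN = "?N \<Otimes>\<^sub>M (?O \<Otimes>\<^sub>M ?NE)"
    have gNN: "(\<lambda>q. g m k (fst q) (u q)) \<in> ?NN \<rightarrow>\<^sub>M count_space {0, 1}"
      if m: "m \<in> {1..M}" and u: "u \<in> ?NN \<rightarrow>\<^sub>M borel" for m u
    proof -
      have "(\<lambda>q. (fst q, u q)) \<in> ?NN \<rightarrow>\<^sub>M ?N \<Otimes>\<^sub>M borel"
        by (intro measurable_Pair measurable_fst u)
      from measurable_compose[OF this g[rule_format, OF m k]] show ?thesis by simp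
    qed
    have cur: "(\<lambda>q. fst (snd q)) \<in> ?NN \<rightarrow>\<^sub>M ?O"
      by (intro measurable_compose[OF measurable_snd measurable_fst])
    have coord: "(\<lambda>q. snd (snd q) j) \<in> ?NN \<rightarrow>\<^sub>M ?O" if "j \<in> {k+1..k+l}" for j
      by (intro measurable_compose[OF measurable_compose[OF measurable_snd measurable_snd]]
          measurable_component_singleton that)
    have [measurable]: "(\<lambda>q. weighted_vote M \<alpha> (\<lambda>m. g m k (fst q)) k l (snd (snd q)) (fst (fst (snd q))))
        \<in> borel_measurable ?NN"
    proof (rule measurable_weighted_vote)
      fix m assume m: "m \<in> {1..M}"
      show "(\<lambda>q. g m k (fst q) (fst (fst (snd q)))) \<in> ?NN \<rightarrow>\<^sub>M count_space {0, 1}"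
        by (rule gNN[OF m measurable_compose[OF cur fsto]])
      fix j assume j: "j \<in> {k+1..k+l}"
      show "(\<lambda>q. g m k (fst q) (fst (snd (snd q) j))) \<in> ?NN \<rightarrow>\<^sub>M count_space {0, 1}"
        by (rule gNN[OF m measurable_compose[OF coord[OF j] fsto]])
    next
      fix j assume j: "j \<in> {k+1..k+l}"
      show "(\<lambda>q. real (snd (snd (snd q) j))) \<in> borel_measurable ?NN"
        by (rule measurable_compose[OF measurable_compose[OF coord[OF j] sndo]]) simp
    qed
    have [measurable]: "Measurable.pred ?NN (\<lambda>q. rule k l (fst q) (snd (snd q)) (fst (fst (snd q))) = snd (fst (snd q)))"
    proof (rule pred_binary_eq)
      show "(\<lambda>q. rule k l (fst q) (snd (snd q)) (fst (fst (snd q)))) \<in> ?NN \<rightarrow>\<^sub>M count_space {0, 1}"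
        unfolding rule_def by measurable
    qed (rule measurable_compose[OF cur sndo])
    have "AE \<omega> in P. real_cond_exp P (vimage_algebra (space P) (first_sample D k) ?N)
        (indicator {\<omega> \<in> space P. rule k l (first_sample D k \<omega>) (snd (?Z \<omega>)) (fst (fst (?Z \<omega>))) \<noteq> snd (fst (?Z \<omega>))}) \<omega>
      = measure (distr P (?O \<Otimes>\<^sub>M ?NE) ?Z) {z \<in> space (distr P (?O \<Otimes>\<^sub>M ?NE) ?Z).
          rule k l (first_sample D k \<omega>) (snd z) (fst (fst z)) \<noteq> snd (fst z)}"
      by (rule real_cond_exp_indicator_indep[OF P Sm Z law]) measurable
    moreover have "rule k l (first_sample D k \<omega>) (snd (?Z \<omega>)) (fst (fst (?Z \<omega>)))
        = aggregated_classifier M \<alpha> g D k l \<omega> (X \<omega>)" for \<omega>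
    proof -
      have "weighted_vote M \<alpha> (\<lambda>m. g m k (first_sample D k \<omega>)) k l (\<lambda>i\<in>{k+1..k+l}. D i \<omega>) (X \<omega>)
          = weighted_vote M \<alpha> (\<lambda>m. g m k (first_sample D k \<omega>)) k l (\<lambda>i. D i \<omega>) (X \<omega>)"
        by (rule weighted_vote_cong) simp
      then show ?thesis
        by (simp only: rule_def aggregated_classifier_def U_def fst_conv snd_conv)
    qed
    ultimately show ?thesis
      unfolding aggregated_risk_def prob_given_first_def risk_def lawZ
      by (simp only: U_def fst_conv snd_conv case_prod_beta' prod.collapse)
  qed

  have bound: "\<bar>risk k l d - bayes_risk P X Y \<eta>\<bar>
      \<le> (1 + 1/c) * (\<Sum>m=1..R. err m k d) + exp (- (c\<^sup>2 / 2) * real l)"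
    if k: "k \<ge> 1" and d: "d \<in> space (\<Pi>\<^sub>M i\<in>{1..k}. obs_space)" for k l d
  proof -
    have "g m k d \<in> borel \<rightarrow>\<^sub>M count_space {0, 1}" if "m \<in> {1..M}" for m
      using measurable_compose[OF measurable_Pair1'[OF d] g[rule_format, OF that k]] by simp
    from vote_excess_risk_bound[OF MR Q sQ this s gap_ge c, where k = k and l = l]
    show ?thesis unfolding risk_def err_def bayes rule_def .
  qed
  have "AE \<omega> in P. \<forall>k. \<forall>l. k \<ge> 1 \<longrightarrow> l \<ge> 1 \<longrightarrow>
      \<bar>aggregated_risk P X Y D M \<alpha> g k l \<omega> - bayes_risk P X Y \<eta>\<bar>
        \<le> (1 + 1/c) * (\<Sum>m=1..R. classifier_error P X D \<eta> g m k \<omega>) + exp (- (c\<^sup>2 / 2) * real l)"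
  proof (subst AE_all_countable, intro allI, subst AE_all_countable, intro allI, cases)
    fix k l :: nat assume kl: "k \<ge> 1 \<and> l \<ge> 1"
    have "AE \<omega> in P. \<forall>m\<in>{1..R}. classifier_error P X D \<eta> g m k \<omega> = err m k (first_sample D k \<omega>)"
      using error kl MR(3) by (intro AE_finite_allI) auto
    moreover have "AE \<omega> in P. aggregated_risk P X Y D M \<alpha> g k l \<omega> = risk k l (first_sample D k \<omega>)"
      using agg kl by auto
    ultimately show "AE \<omega> in P. k \<ge> 1 \<longrightarrow> l \<ge> 1 \<longrightarrow>
      \<bar>aggregated_risk P X Y D M \<alpha> g k l \<omega> - bayes_risk P X Y \<eta>\<bar>
        \<le> (1 + 1/c) * (\<Sum>m=1..R. classifier_error P X D \<eta> g m k \<omega>) + exp (- (c\<^sup>2 / 2) * real l)"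
      using AE_space
    proof eventually_elim
      case (elim \<omega>)
      have "(\<Sum>m=1..R. classifier_error P X D \<eta> g m k \<omega>) = (\<Sum>m=1..R. err m k (first_sample D k \<omega>))"
        using elim(1) by (intro sum.cong) auto
      moreover have "first_sample D k \<omega> \<in> space (\<Pi>\<^sub>M i\<in>{1..k}. obs_space)"
        using measurable_space[OF Sm elim(3)] .
      ultimately show ?case using bound[of k "first_sample D k \<omega>" l] kl elim(2) by simp
    qed
  qed (auto intro!: AE_I2)
  then show ?thesis
    by (intro that[of "1 + 1/c" "c\<^sup>2 / 2"]) (use c in \<open>auto elim!: eventually_mono\<close>)
qed

theorem theorem1:
  fixes P :: "'w measure"
    and X :: "'w \<Rightarrow> 'a::polish_space" and Y :: "'w \<Rightarrow> nat"
    and D :: "nat \<Rightarrow> 'w \<Rightarrow> 'a \<times> nat"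
    and \<eta> :: "'a \<Rightarrow> real"
    and g :: "nat \<Rightarrow> nat \<Rightarrow> (nat \<Rightarrow> 'a \<times> nat) \<Rightarrow> 'a \<Rightarrow> nat"
    and M R :: nat and \<alpha> :: real
  assumes "prob_space P"
    and "X \<in> P \<rightarrow>\<^sub>M borel" and "Y \<in> P \<rightarrow>\<^sub>M count_space {0, 1}"
    and "regression_function P X Y \<eta>"
    and "prob_space.indep_vars P (\<lambda>_. obs_space) D {1..}"
    and "\<forall>i\<ge>1. distr P obs_space (D i) = distr P obs_space (\<lambda>\<omega>. (X \<omega>, Y \<omega>))"
    and "\<forall>n. prob_space.indep_set P
               (sets (vimage_algebra (space P) (\<lambda>\<omega>. (X \<omega>, Y \<omega>)) obs_space))
               (sets (vimage_algebra (space P) (first_sample D n) (\<Pi>\<^sub>M i\<in>{1..n}. obs_space)))"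
    and "\<forall>m\<in>{1..M}. \<forall>k\<ge>1. (\<lambda>(d, x). g m k d x)
               \<in> (\<Pi>\<^sub>M i\<in>{1..k}. obs_space) \<Otimes>\<^sub>M borel \<rightarrow>\<^sub>M count_space {0, 1}"
    and "M \<ge> 1" and "0 \<le> \<alpha>" and "\<alpha> < 1/2"
    and "R \<in> {1..M}" and "real R \<ge> real M * (1 - \<alpha>)"
    and "\<forall>m\<in>{1..R}. tendsto_in_prob P (\<lambda>k. classifier_error P X D \<eta> g m k) 0 sequentially"
    and "\<P>(\<omega> in P. Y \<omega> = 1 \<bar> bayes_rule \<eta> (X \<omega>) = 1) > 1/2"
    and "\<P>(\<omega> in P. Y \<omega> = 0 \<bar> bayes_rule \<eta> (X \<omega>) = 0) > 1/2"
  shows "tendsto_in_prob P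
           (\<lambda>(k, l) \<omega>. aggregated_risk P X Y D M \<alpha> g k l \<omega> - bayes_risk P X Y \<eta>) 0
           (filtercomap (\<lambda>(k, l). min k l) sequentially)
       \<and> (\<forall>\<beta> :: nat \<Rightarrow> nat \<Rightarrow> real.
            (\<forall>m\<in>{1..R}. (\<forall>k\<ge>1. \<beta> m k \<ge> 0) \<and> \<beta> m \<longlonglongrightarrow> 0) \<longrightarrow>
            (\<forall>m\<in>{1..R}. AE \<omega> in P. \<exists>A k0. \<forall>k\<ge>k0.
               \<bar>classifier_error P X D \<eta> g m k \<omega>\<bar> \<le> A * \<beta> m k) \<longrightarrow>
            (\<exists>C>0. AE \<omega> in P. \<exists>A k0. \<forall>k\<ge>k0. \<forall>l\<ge>1.
               \<bar>aggregated_risk P X Y D M \<alpha> g k l \<omega> - bayes_risk P X Y \<eta>\<bar>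
                 \<le> A * max (exp (- C * real l)) (MAX m\<in>{1..R}. \<beta> m k)))"
proof -
  interpret prob_space P by (rule assms(1))
  let ?agg = "\<lambda>k l \<omega>. aggregated_risk P X Y D M \<alpha> g k l \<omega> - bayes_risk P X Y \<eta>"
  let ?err = "\<lambda>m k \<omega>. classifier_error P X D \<eta> g m k \<omega>"
  have R: "R \<ge> 1" using assms(12) by simp
  have \<eta>: "\<eta> \<in> borel_measurable borel" using assms(4) by (simp add: regression_function_def)
  obtain K C where K: "K \<ge> 0" and C: "C > 0" and bound: "AE \<omega> in P. \<forall>k\<ge>1. \<forall>l\<ge>1.
      \<bar>?agg k l \<omega>\<bar> \<le> K * (\<Sum>m=1..R. ?err m k \<omega>) + exp (- C * real l)"
    by (rule aggregated_excess_risk_bound[OF assms(1-3) \<eta> assms(5-9) assms(11-13) assms(15,16)])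
  have prob_given_first_measurable [measurable]: "prob_given_first P D k A \<in> borel_measurable P" for k A
    unfolding prob_given_first_def by (rule borel_measurable_cond_exp2)
  have [measurable]: "?err m k \<in> borel_measurable P" "aggregated_risk P X Y D M \<alpha> g k l \<in> borel_measurable P" for m k l
    unfolding classifier_error_def aggregated_risk_def by (rule prob_given_first_measurable)+

  let ?F = "filtercomap (\<lambda>(k, l). min k l) sequentially :: (nat \<times> nat) filter"
  have large: "eventually (\<lambda>(k, l). k \<ge> n \<and> l \<ge> n) ?F" for n
    by (rule eventually_mono[OF eventually_filtercomapI[OF eventually_ge_at_top[of n]]]) auto
  have k_large: "filterlim fst sequentially ?F"
    unfolding filterlim_at_top by (intro allI eventually_mono[OF large]) auto
  have a: "tendsto_in_prob P (\<lambda>(k, l) \<omega>. ?agg k l \<omega>) 0 ?F"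
    unfolding tendsto_in_prob_def
  proof (intro allI impI)
    fix \<epsilon> :: real assume \<epsilon>: "\<epsilon> > 0"
    \<comment> \<open>If all \<open>R\<close> errors are at most \<open>\<delta>\<close>, they contribute at most \<open>\<epsilon>/2\<close>; the exponential contributes the other half.\<close>
    define \<delta> where "\<delta> = \<epsilon> / (2 * (K + 1) * real R)"
    have \<delta>: "\<delta> > 0" using \<epsilon> K R by (simp add: \<delta>_def)
    have K\<delta>: "K * (real R * \<delta>) \<le> \<epsilon> / 2"
    proof -
      have "real R * \<delta> = \<epsilon> / (2 * (K + 1))" using R by (simp add: \<delta>_def)
      then have "K * (real R * \<delta>) = K / (K + 1) * (\<epsilon> / 2)" by simp
      also have "\<dots> \<le> 1 * (\<epsilon> / 2)" using K \<epsilon> by (intro mult_right_mono) auto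
      finally show ?thesis by simp
    qed
    have "(\<lambda>l. exp (- C) ^ l) \<longlonglongrightarrow> 0" using C by (intro LIMSEQ_realpow_zero) auto
    then have "eventually (\<lambda>l. exp (- C) ^ l < \<epsilon> / 2) sequentially"
      using \<epsilon> by (intro order_tendstoD(2)) auto
    then obtain n where n: "exp (- C * real l) \<le> \<epsilon> / 2" if "l \<ge> n" for l
      unfolding eventually_sequentially by (force simp: exp_of_nat_mult[symmetric] mult.commute)
    let ?bad = "\<lambda>m k. {\<omega> \<in> space P. \<bar>?err m k \<omega> - 0\<bar> > \<delta>}"
    have tail: "\<P>(\<omega> in P. \<bar>?agg k l \<omega> - 0\<bar> > \<epsilon>) \<le> (\<Sum>m=1..R. prob (?bad m k))"
      if kl: "k \<ge> max 1 n" "l \<ge> max 1 n" for k l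
    proof -
      have "\<P>(\<omega> in P. \<bar>?agg k l \<omega> - 0\<bar> > \<epsilon>) \<le> prob (\<Union>m\<in>{1..R}. ?bad m k)"
      proof (rule finite_measure_mono_AE)
        show "AE \<omega> in P. \<omega> \<in> {\<omega> \<in> space P. \<bar>?agg k l \<omega> - 0\<bar> > \<epsilon>} \<longrightarrow> \<omega> \<in> (\<Union>m\<in>{1..R}. ?bad m k)"
          using bound
        proof eventually_elim
          case (elim \<omega>)
          show ?case
          proof (rule impI, rule ccontr)
            assume \<omega>: "\<omega> \<in> {\<omega> \<in> space P. \<bar>?agg k l \<omega> - 0\<bar> > \<epsilon>}" "\<omega> \<notin> (\<Union>m\<in>{1..R}. ?bad m k)"
            then have "?err m k \<omega> \<le> \<delta>" if "m \<in> {1..R}" for m using that by force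
            then have "(\<Sum>m=1..R. ?err m k \<omega>) \<le> (\<Sum>m=1..R. \<delta>)" by (intro sum_mono)
            then have "(\<Sum>m=1..R. ?err m k \<omega>) \<le> real R * \<delta>" by simp
            then have "K * (\<Sum>m=1..R. ?err m k \<omega>) \<le> \<epsilon> / 2"
              using mult_left_mono[OF _ K] K\<delta> by (meson order.trans)
            moreover have "\<bar>?agg k l \<omega>\<bar> \<le> K * (\<Sum>m=1..R. ?err m k \<omega>) + exp (- C * real l)"
              using elim kl by simp
            ultimately show False using \<omega>(1) n[of l] kl by simp
          qed
        qed
      qed measurable
      also have "\<dots> \<le> (\<Sum>m=1..R. prob (?bad m k))"
        by (intro finite_measure_subadditive_finite) auto
      finally show ?thesis .
    qed
    have "(\<lambda>k. \<Sum>m=1..R. prob (?bad m k)) \<longlonglongrightarrow> (\<Sum>m=1..R. 0)"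
      using assms(14) \<delta> unfolding tendsto_in_prob_def by (intro tendsto_sum) blast
    then have "((\<lambda>p. \<Sum>m=1..R. prob (?bad m (fst p))) \<longlongrightarrow> 0) ?F"
      using filterlim_compose[OF _ k_large] by simp
    then show "((\<lambda>i. \<P>(\<omega> in P. \<bar>(case i of (k, l) \<Rightarrow> \<lambda>\<omega>. ?agg k l \<omega>) \<omega> - 0\<bar> > \<epsilon>)) \<longlongrightarrow> 0) ?F"
    proof (rule tendsto_sandwich[OF _ _ tendsto_const, rotated 2])
      show "eventually (\<lambda>i. \<P>(\<omega> in P. \<bar>(case i of (k, l) \<Rightarrow> \<lambda>\<omega>. ?agg k l \<omega>) \<omega> - 0\<bar> > \<epsilon>)
          \<le> (\<Sum>m=1..R. prob (?bad m (fst i)))) ?F"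
        by (rule eventually_mono[OF large[of "max 1 n"]]) (use tail in auto)
    qed simp
  qed

  have b: "AE \<omega> in P. \<exists>A k0. \<forall>k\<ge>k0. \<forall>l\<ge>1.
      \<bar>?agg k l \<omega>\<bar> \<le> A * max (exp (- C * real l)) (MAX m\<in>{1..R}. \<beta> m k)"
    if \<beta>: "\<forall>m\<in>{1..R}. (\<forall>k\<ge>1. \<beta> m k \<ge> 0) \<and> \<beta> m \<longlonglongrightarrow> 0"
      and rate: "\<forall>m\<in>{1..R}. AE \<omega> in P. \<exists>A k0. \<forall>k\<ge>k0. \<bar>?err m k \<omega>\<bar> \<le> A * \<beta> m k"
    for \<beta> :: "nat \<Rightarrow> nat \<Rightarrow> real"
  proof -
    have "AE \<omega> in P. \<forall>m\<in>{1..R}. \<exists>A k0. \<forall>k\<ge>k0. \<bar>?err m k \<omega>\<bar> \<le> A * \<beta> m k"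
      using rate by (intro AE_finite_allI) auto
    then show ?thesis using bound
    proof eventually_elim
      case (elim \<omega>)
      from elim(1) obtain A k0 where A: "\<And>m k. m \<in> {1..R} \<Longrightarrow> k \<ge> k0 m \<Longrightarrow> \<bar>?err m k \<omega>\<bar> \<le> A m * \<beta> m k"
        by metis
      \<comment> \<open>\<open>A\<close> may take negative values, hence the absolute values.\<close>
      define S where "S = (\<Sum>m=1..R. \<bar>A m\<bar>)"
      show ?case
      proof (intro exI allI impI)
        \<comment> \<open>A sum bounds the maximum of the \<open>k0 m\<close>; the 1 excludes \<open>k = 0\<close>, where nothing is known of the classifiers.\<close>
        fix k l :: nat assume k: "k \<ge> 1 + (\<Sum>m=1..R. k0 m)" and l: "l \<ge> 1"
        define \<mu> where "\<mu> = (MAX m\<in>{1..R}. \<beta> m k)"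
        define mx where "mx = max (exp (- C * real l)) \<mu>"
        have "?err m k \<omega> \<le> \<bar>A m\<bar> * mx" if m: "m \<in> {1..R}" for m
        proof -
          have "k0 m \<le> (\<Sum>m=1..R. k0 m)" using m by (intro member_le_sum) auto
          then have "?err m k \<omega> \<le> A m * \<beta> m k" using A[OF m, of k] k by linarith
          also have "\<dots> \<le> \<bar>A m\<bar> * \<beta> m k" using \<beta> m k by (intro mult_right_mono) auto
          also have "\<beta> m k \<le> \<mu>" unfolding \<mu>_def using m by (intro Max_ge) auto
          then have "\<bar>A m\<bar> * \<beta> m k \<le> \<bar>A m\<bar> * mx" by (intro mult_left_mono) (auto simp: mx_def)
          finally show ?thesis .
        qed
        then have "(\<Sum>m=1..R. ?err m k \<omega>) \<le> S * mx"
          unfolding S_def sum_distrib_right by (intro sum_mono)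
        then have "K * (\<Sum>m=1..R. ?err m k \<omega>) \<le> K * (S * mx)" using K by (rule mult_left_mono)
        moreover have "\<bar>?agg k l \<omega>\<bar> \<le> K * (\<Sum>m=1..R. ?err m k \<omega>) + exp (- C * real l)"
          using elim(2) k l by simp
        moreover have "exp (- C * real l) \<le> mx" by (simp add: mx_def)
        ultimately have "\<bar>?agg k l \<omega>\<bar> \<le> (K * S + 1) * mx" by (simp add: algebra_simps)
        then show "\<bar>?agg k l \<omega>\<bar> \<le> (K * S + 1) * max (exp (- C * real l)) (MAX m\<in>{1..R}. \<beta> m k)"
          unfolding mx_def \<mu>_def .
      qed
    qed
  qed
  show ?thesis using a b C by blast
qed

end
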